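(* Let $S$ be a semitopological semigroup such that $LMC(S)$ has a left invariant mean. Then $S$ has the following fixed point property $(G)$: for every locally convex space $X$ whose topology is determined by a family $Q$ of continuous seminorms and every nonempty weakly compact convex subset $K$ of $X$, every $Q$-nonexpansive dynamical system $(S,(K,\mathrm{weak}))$ has a fixed point.
   Context: A semitopological semigroup is a (nonempty) semigroup $S$ with a Hausdorff topology such that for each $t\in S$ the maps $s\mapsto ts$ and $s\mapsto st$ are continuous. $\ell^\infty(S)$ is the Banach space of bounded complex-valued functions on $S$ with the supremum norm; for $s\in S$, $L_sf(t)=f(st)$ and $R_sf(t)=f(ts)$. $C(S)$ is the closed subalgebra of bounded continuous functions. A mean on $C(S)$ is $\mu\in C(S)^*$ with $\|\mu\|=\mu(1)=1$; it is multiplicative if $\mu(fg)=\mu(f)\mu(g)$ for all $f,g$. $LMC(S)$ is the space of $f\in C(S)$ for which $s\mapsto L_sf$ is continuous from $S$ to $C(S)$ when $C(S)$ is given the topology induced by the multiplicative means on $C(S)$ (the weakest topology making all of them continuous). If $Y$ is a closed linear subspace of $\ell^\infty(S)$ containing constants with $L_s(Y)\subset Y$, $R_s(Y)\subset Y$ for all $s$ (as is $LMC(S)$), a left invariant mean on $Y$ is $\mu\in Y^*$ with $\|\mu\|=\mu(1)=1$ and $\mu(L_sf)=\mu(f)$ for all $s\in S$, $f\in Y$. Locally convex spaces are Hausdorff. A dynamical system $(S,K)$ consists of a semitopological semigroup $S$, a topological space $K$ and an action $S\times K\to K$, $(s,x)\mapsto sx$, with $s_1(s_2x)=(s_1s_2)x$,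 which is separately continuous (all maps $s\mapsto sx$ and all translations $x\mapsto sx$ are continuous). $(S,(K,\mathrm{weak}))$ means that $K$ carries the weak topology. For $K$ in a locally convex space with topology determined by the family $Q$ of seminorms, the system is $Q$-nonexpansive if $p(sx-sy)\le p(x-y)$ for all $p\in Q$, $s\in S$, $x,y\in K$. A fixed point is $x\in K$ with $sx=x$ for all $s\in S$. *)

theory Defs
  imports "HOL-Analysis.Analysis"
begin

section \<open>Semitopological semigroups and means\<close>

class semitopological_semigroup = semigroup_mult + t2_space +
  assumes open_vimage_mult_left: "open U \<Longrightarrow> open ((\<lambda>s. t * s) -` U)"
    and open_vimage_mult_right: "open U \<Longrightarrow> open ((\<lambda>s. s * t) -` U)"

lemma continuous_on_translations:
  fixes t :: "'s::semitopological_semigroup"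
  shows "continuous_on UNIV (\<lambda>s. t * s)" and "continuous_on UNIV (\<lambda>s. s * t)"
  by (simp_all add: continuous_on_open_vimage open_vimage_mult_left open_vimage_mult_right)

definition left_translate :: "'s::semigroup_mult \<Rightarrow> ('s \<Rightarrow> complex) \<Rightarrow> 's \<Rightarrow> complex" where
  "left_translate s f = (\<lambda>t. f (s * t))"

definition sup_norm :: "('s \<Rightarrow> complex) \<Rightarrow> real" where
  "sup_norm f = (SUP s. norm (f s))"

text \<open>
  Subspaces of the bounded functions are represented by sets of functions, and functionals
  by functions of which only the values on the subspace matter. The space \<open>C(S)\<close> is the
  library set \<^term>\<open>bcontfun\<close>.
\<close>

definition dual_space :: "('s \<Rightarrow> complex) set \<Rightarrow> (('s \<Rightarrow> complex) \<Rightarrow> complex) set" where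
  "dual_space Y = {\<mu>.
     (\<forall>f\<in>Y. \<forall>g\<in>Y. \<mu> (\<lambda>s. f s + g s) = \<mu> f + \<mu> g) \<and>
     (\<forall>c. \<forall>f\<in>Y. \<mu> (\<lambda>s. c * f s) = c * \<mu> f) \<and>
     (\<exists>B. \<forall>f\<in>Y. norm (\<mu> f) \<le> B * sup_norm f)}"

definition dual_norm :: "('s \<Rightarrow> complex) set \<Rightarrow> (('s \<Rightarrow> complex) \<Rightarrow> complex) \<Rightarrow> real" where
  "dual_norm Y \<mu> = (SUP f\<in>{f\<in>Y. sup_norm f \<le> 1}. norm (\<mu> f))"

definition mean_on :: "('s \<Rightarrow> complex) set \<Rightarrow> (('s \<Rightarrow> complex) \<Rightarrow> complex) \<Rightarrow> bool" where
  "mean_on Y \<mu> \<longleftrightarrow> \<mu> \<in> dual_space Y \<and> dual_norm Y \<mu> = 1 \<and> \<mu> (\<lambda>_. 1) = 1"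

definition left_invariant_mean_on ::
    "('s::semigroup_mult \<Rightarrow> complex) set \<Rightarrow> (('s \<Rightarrow> complex) \<Rightarrow> complex) \<Rightarrow> bool" where
  "left_invariant_mean_on Y \<mu> \<longleftrightarrow>
     mean_on Y \<mu> \<and> (\<forall>s. \<forall>f\<in>Y. \<mu> (left_translate s f) = \<mu> f)"

definition multiplicative_mean ::
    "(('s::topological_space \<Rightarrow> complex) \<Rightarrow> complex) \<Rightarrow> bool" where
  "multiplicative_mean \<mu> \<longleftrightarrow>
     mean_on bcontfun \<mu> \<and>
     (\<forall>f\<in>bcontfun. \<forall>g\<in>bcontfun. \<mu> (\<lambda>s. f s * g s) = \<mu> f * \<mu> g)"

definition multiplicative_mean_topology :: "('s::topological_space \<Rightarrow> complex) topology" where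
  "multiplicative_mean_topology =
     topology_generated_by {{f \<in> bcontfun. \<mu> f \<in> U} | \<mu> U. multiplicative_mean \<mu> \<and> open U}"

definition LMC :: "('s::semitopological_semigroup \<Rightarrow> complex) set" where
  "LMC = {f \<in> bcontfun.
     continuous_map euclidean multiplicative_mean_topology (\<lambda>s. left_translate s f)}"


section \<open>Locally convex spaces\<close>

text \<open>
  The scalar field is a type of sort \<open>{real_normed_field, euclidean_space}\<close>. Its instances
  \<^typ>\<open>real\<close> and \<^typ>\<open>complex\<close> are, up to isomorphism, the only such fields, so that real and
  complex spaces are treated together. The class \<^class>\<open>real_vector\<close> on the vectors supplies the
  underlying real structure, which is required to agree with that of the scalar multiplication.
\<close>

definition seminorm_on_space ::
    "('k::real_normed_field \<Rightarrow> 'x::real_vector \<Rightarrow> 'x) \<Rightarrow> ('x \<Rightarrow> real) \<Rightarrow> bool" where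
  "seminorm_on_space scal p \<longleftrightarrow>
     (\<forall>x. 0 \<le> p x) \<and>
     (\<forall>c x. p (scal c x) = norm c * p x) \<and>
     (\<forall>x y. p (x + y) \<le> p x + p y)"

text \<open>The set \<^term>\<open>UNIV\<close> only matters for empty \<open>Q\<close>, when it makes the topology indiscrete.\<close>

definition seminorm_topology :: "('x::real_vector \<Rightarrow> real) set \<Rightarrow> 'x topology" where
  "seminorm_topology Q =
     topology_generated_by (insert UNIV {{y. p (y - x) < r} | p x r. p \<in> Q \<and> 0 < r})"

definition locally_convex_space ::
    "('k::{real_normed_field,euclidean_space} \<Rightarrow> 'x::real_vector \<Rightarrow> 'x)
      \<Rightarrow> ('x \<Rightarrow> real) set \<Rightarrow> bool" where
  "locally_convex_space scal Q \<longleftrightarrow>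
     vector_space scal \<and> (\<forall>r x. scal (of_real r) x = r *\<^sub>R x) \<and>
     (\<forall>p\<in>Q. seminorm_on_space scal p) \<and> Hausdorff_space (seminorm_topology Q)"

definition weak_topology ::
    "('k::{real_normed_field,euclidean_space} \<Rightarrow> 'x::real_vector \<Rightarrow> 'x)
      \<Rightarrow> 'x topology \<Rightarrow> 'x topology" where
  "weak_topology scal T =
     topology_generated_by {f -` U | (f :: 'x \<Rightarrow> 'k) U.
       Vector_Spaces.linear scal (*) f \<and> continuous_map T euclidean f \<and> open U}"


section \<open>Dynamical systems\<close>

definition dynamical_system ::
    "'x topology \<Rightarrow> ('s::semitopological_semigroup \<Rightarrow> 'x \<Rightarrow> 'x) \<Rightarrow> bool" where
  "dynamical_system K act \<longleftrightarrow>
     (\<forall>s t. \<forall>x\<in>topspace K. act s (act t x) = act (s * t) x) \<and>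
     (\<forall>x\<in>topspace K. continuous_map euclidean K (\<lambda>s. act s x)) \<and>
     (\<forall>s. continuous_map K K (act s))"

definition nonexpansive_action ::
    "('x::real_vector \<Rightarrow> real) set \<Rightarrow> 'x set \<Rightarrow> ('s \<Rightarrow> 'x \<Rightarrow> 'x) \<Rightarrow> bool" where
  "nonexpansive_action Q K act \<longleftrightarrow>
     (\<forall>p\<in>Q. \<forall>s. \<forall>x\<in>K. \<forall>y\<in>K. p (act s x - act s y) \<le> p (x - y))"

end

theory Submission
  imports Defs
begin

text \<open>
  Let \<open>K0 \<subseteq> K\<close> be a minimal nonempty weakly compact convex invariant set and \<open>F \<subseteq> K0\<close> a minimal
  nonempty weakly compact invariant set. For \<open>x \<in> F\<close> and weakly continuous \<open>f\<close> on \<open>F\<close> the function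
  \<open>s \<mapsto> f (s x)\<close> lies in \<open>LMC(S)\<close>, because a multiplicative mean acts on the functions of this form
  as evaluation at a point of \<open>F\<close>. So a left invariant mean on \<open>LMC(S)\<close> induces an invariant mean
  on \<open>C(F)\<close>. By minimality of \<open>F\<close> it is strictly positive, and therefore \<open>s F = F\<close> for all \<open>s\<close>.

  For every \<open>p \<in> Q\<close> the set \<open>F\<close> is totally bounded: weakly compact sets are fragmented by \<open>p\<close>,
  so some nonempty weakly open \<open>U \<subseteq> F\<close> has small \<open>p\<close>-diameter; the translates \<open>s U\<close> are
  \<open>p\<close>-small as well and all have at least the mass of \<open>U\<close>, so only finitely many of them are disjoint,
  and \<open>F\<close> is covered by finitely many small \<open>p\<close>-balls. If \<open>F\<close> had two points, DeMarr's lemma would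
  give a point of \<open>K0\<close> whose \<open>p\<close>-distances to the points of \<open>F\<close> are at most some \<open>r\<close> below the
  \<open>p\<close>-diameter of \<open>F\<close>; as \<open>s F = F\<close>, the set of all such points of \<open>K0\<close> is invariant, convex and
  weakly closed, hence equal to \<open>K0\<close>, which contains \<open>F\<close>: a contradiction.
\<close>

section \<open>The Hahn--Banach theorem\<close>

text \<open>Homogeneity is asked only as an inequality for \<open>r > 0\<close>, the form that
  infima of such functionals yield directly; equality follows by applying it to \<open>r\<close> and
  to \<open>inverse r\<close>.\<close>

definition sublinear :: "('x::real_vector \<Rightarrow> real) \<Rightarrow> bool" where
  "sublinear f \<longleftrightarrow>
     (\<forall>x y. f (x + y) \<le> f x + f y) \<and> (\<forall>r>0. \<forall>x. f (r *\<^sub>R x) \<le> r * f x)"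

lemma sublinear_zero:
  assumes "sublinear f"
  shows "f 0 = 0"
proof -
  have "f ((1/2) *\<^sub>R 0) \<le> (1/2) * f 0" "f (2 *\<^sub>R 0) \<le> 2 * f 0"
    using assms unfolding sublinear_def by (meson zero_less_numeral half_gt_zero_iff zero_less_one)+
  then show ?thesis by simp
qed

lemma sublinear_scaleR:
  assumes "sublinear f" "0 \<le> r"
  shows "f (r *\<^sub>R x) = r * f x"
proof (cases "r = 0")
  case True
  then show ?thesis using sublinear_zero[OF assms(1)] by simp
next
  case False
  then have r: "0 < r" using assms by simp
  have "f (inverse r *\<^sub>R (r *\<^sub>R x)) \<le> inverse r * f (r *\<^sub>R x)"
    using assms(1) r unfolding sublinear_def by (meson positive_imp_inverse_positive)
  then have "r * f x \<le> f (r *\<^sub>R x)"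
    using r by (simp add: field_simps)
  moreover have "f (r *\<^sub>R x) \<le> r * f x"
    using assms(1) r unfolding sublinear_def by blast
  ultimately show ?thesis by simp
qed

lemma sublinear_add: "sublinear f \<Longrightarrow> f (x + y) \<le> f x + f y"
  by (simp add: sublinear_def)

lemma sublinear_minus:
  assumes "sublinear f"
  shows "- f (- x) \<le> f x"
  using sublinear_add[OF assms, of x "- x"] sublinear_zero[OF assms] by simp

text \<open>
  The sublinear functional \<open>tilt f z \<le> f\<close> satisfies \<open>tilt f z (- z) \<le> - f z\<close>. Hence a minimal
  sublinear functional is odd, and therefore linear.
\<close>

definition tilt :: "('x::real_vector \<Rightarrow> real) \<Rightarrow> 'x \<Rightarrow> 'x \<Rightarrow> real" where
  "tilt f z x = (INF t\<in>{0..}. f (x + t *\<^sub>R z) - t * f z)"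

lemma tilt_le:
  assumes "sublinear f" "0 \<le> t"
  shows "tilt f z x \<le> f (x + t *\<^sub>R z) - t * f z"
  unfolding tilt_def
proof (rule cINF_lower)
  have "- f (- x) \<le> f (x + t *\<^sub>R z) - t * f z" if "0 \<le> t" for t
    using sublinear_add[OF assms(1), of "x + t *\<^sub>R z" "- x"] sublinear_scaleR[OF assms(1) that, of z]
    by simp
  then show "bdd_below ((\<lambda>t. f (x + t *\<^sub>R z) - t * f z) ` {0..})"
    by (auto intro!: bdd_belowI)
qed (use assms in simp)

lemma le_tiltI: "(\<And>t. 0 \<le> t \<Longrightarrow> c \<le> f (x + t *\<^sub>R z) - t * f z) \<Longrightarrow> c \<le> tilt f z x"
  unfolding tilt_def by (rule cINF_greatest) auto

lemma sublinear_tilt: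
  assumes f: "sublinear f"
  shows "sublinear (tilt f z)"
  unfolding sublinear_def
proof (intro conjI allI impI)
  fix x y
  \<comment> \<open>The parameters \<open>t\<close> for \<open>x\<close> and \<open>s\<close> for
    \<open>y\<close> combine to \<open>t + s\<close> for \<open>x + y\<close>; the two infima are
    then taken one after the other.\<close>
  have *: "tilt f z (x + y) - (f (y + s *\<^sub>R z) - s * f z) \<le> f (x + t *\<^sub>R z) - t * f z"
    if "0 \<le> t" "0 \<le> s" for t s
    using tilt_le[OF f, of "t + s" z "x + y"] that
      sublinear_add[OF f, of "x + t *\<^sub>R z" "y + s *\<^sub>R z"]
    by (simp add: algebra_simps)
  have "tilt f z (x + y) - tilt f z x \<le> f (y + s *\<^sub>R z) - s * f z" if "0 \<le> s" for s
    using le_tiltI[OF *[OF _ that]] by (simp add: algebra_simps)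
  then have "tilt f z (x + y) - tilt f z x \<le> tilt f z y"
    by (rule le_tiltI)
  then show "tilt f z (x + y) \<le> tilt f z x + tilt f z y" by simp
next
  fix r :: real and x
  assume r: "0 < r"
  have "tilt f z (r *\<^sub>R x) / r \<le> f (x + t *\<^sub>R z) - t * f z" if "0 \<le> t" for t
  proof -
    have "tilt f z (r *\<^sub>R x) \<le> f (r *\<^sub>R (x + t *\<^sub>R z)) - (r * t) * f z"
      using tilt_le[OF f, of "r * t" z "r *\<^sub>R x"] that r by (simp add: scaleR_add_right)
    also have "\<dots> = r * (f (x + t *\<^sub>R z) - t * f z)"
      using sublinear_scaleR[OF f, of r "x + t *\<^sub>R z"] r by (simp only: right_diff_distrib mult.assoc)
    finally show ?thesis using r by (simp add: field_simps)
  qed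
  then have "tilt f z (r *\<^sub>R x) / r \<le> tilt f z x" by (rule le_tiltI)
  then show "tilt f z (r *\<^sub>R x) \<le> r * tilt f z x" using r by (simp add: field_simps)
qed

text \<open>Supplies the lower bounds of chains for Zorn's lemma. The chain condition makes the
  infimum subadditive: of two members the smaller one can be used at both points.\<close>

lemma sublinear_INF_chain:
  fixes C :: "('x::real_vector \<Rightarrow> real) set"
  assumes C: "C \<noteq> {}" "\<And>f. f \<in> C \<Longrightarrow> sublinear f"
    and chain: "\<And>f g. f \<in> C \<Longrightarrow> g \<in> C \<Longrightarrow> f \<le> g \<or> g \<le> f"
    and below: "\<And>x. bdd_below ((\<lambda>f. f x) ` C)"
  shows "sublinear (\<lambda>x. INF f\<in>C. f x)"
  unfolding sublinear_def
proof (intro conjI allI impI)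
  fix x y
  let ?I = "\<lambda>x. INF f\<in>C. f x"
  have low: "?I v \<le> f v" if "f \<in> C" for f v
    using below that by (rule cINF_lower)
  have "?I (x + y) - g y \<le> f x" if fg: "f \<in> C" "g \<in> C" for f g
  proof -
    obtain h where h: "h \<in> C" "h \<le> f" "h \<le> g"
      using chain[OF fg] fg by (metis order_refl)
    have "?I (x + y) \<le> h x + h y"
      using low[OF h(1), of "x + y"] sublinear_add[OF C(2)[OF h(1)], of x y] by simp
    also have "\<dots> \<le> f x + g y"
      using h by (simp add: le_fun_def add_mono)
    finally show ?thesis by simp
  qed
  then have "?I (x + y) - g y \<le> ?I x" if "g \<in> C" for g
    using C(1) that by (intro cINF_greatest) auto
  then have "?I (x + y) - ?I x \<le> ?I y"
    using C(1) by (intro cINF_greatest) (auto simp: algebra_simps)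
  then show "?I (x + y) \<le> ?I x + ?I y" by simp
next
  fix r :: real and x
  assume r: "0 < r"
  let ?I = "\<lambda>x. INF f\<in>C. f x"
  have "?I (r *\<^sub>R x) / r \<le> f x" if "f \<in> C" for f
    using cINF_lower[OF below that, of "r *\<^sub>R x"] sublinear_scaleR[OF C(2)[OF that], of r x] r
    by (simp add: field_simps)
  then have "?I (r *\<^sub>R x) / r \<le> ?I x"
    using C(1) by (intro cINF_greatest) auto
  then show "?I (r *\<^sub>R x) \<le> r * ?I x" using r by (simp add: field_simps)
qed

lemma sublinear_dominates_linear:
  assumes q: "sublinear q"
  obtains f where "linear f" "\<And>x. f x \<le> q x"
proof -
  define A where "A = {f. sublinear f \<and> f \<le> q}"
  have "\<exists>f\<in>A. \<forall>g\<in>A. f \<ge> g \<longrightarrow> g = f"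
  proof (rule predicate_Zorn)
    show "partial_order_on A (relation_of (\<ge>) A)"
      by (rule partial_order_on_relation_ofI) auto
  next
    fix C assume C: "C \<in> Chains (relation_of (\<ge>) A)"
    show "\<exists>u\<in>A. \<forall>a\<in>C. a \<ge> u"
    proof (cases "C = {}")
      case True
      then show ?thesis using q by (auto simp: A_def)
    next
      case False
      have CA: "C \<subseteq> A" using C by (rule Chains_relation_of)
      have ch: "f \<le> g \<or> g \<le> f" if "f \<in> C" "g \<in> C" for f g
        using C that by (auto simp: Chains_def relation_of_def)
      \<comment> \<open>Since \<open>- f (- x) \<le> f x\<close>, all sublinear functionals below
        \<open>q\<close> share this lower bound, so chains are pointwise bounded below.\<close>
      have "- q (- x) \<le> f x" if "f \<in> C" for f x
      proof -
        have "sublinear f" "f (- x) \<le> q (- x)"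
          using that CA by (auto simp: A_def le_fun_def)
        then show ?thesis using sublinear_minus[of f x] by simp
      qed
      then have below: "bdd_below ((\<lambda>f. f x) ` C)" for x
        by (auto intro!: bdd_belowI)
      have sub: "sublinear (\<lambda>x. INF f\<in>C. f x)"
        using False CA ch below by (intro sublinear_INF_chain) (auto simp: A_def)
      have le: "(\<lambda>x. INF f\<in>C. f x) \<le> f" if "f \<in> C" for f
        using cINF_lower[OF below that] by (auto simp: le_fun_def)
      obtain f where "f \<in> C" using False by blast
      with CA le have "(\<lambda>x. INF f\<in>C. f x) \<le> q" unfolding A_def by (blast intro: order_trans)
      with sub have "(\<lambda>x. INF f\<in>C. f x) \<in> A" by (simp add: A_def)
      then show ?thesis using le by blast
    qed
  qed
  then obtain f where f: "sublinear f" "f \<le> q"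
    and min: "\<And>g. sublinear g \<Longrightarrow> g \<le> f \<Longrightarrow> g = f"
    unfolding A_def by (blast intro: order_trans)
  have neg: "f (- z) = - f z" for z
  proof -
    have "tilt f z \<le> f"
      using tilt_le[OF f(1), of 0] by (simp add: le_fun_def)
    then have "tilt f z = f" by (rule min[OF sublinear_tilt[OF f(1)]])
    moreover have "tilt f z (- z) \<le> - f z"
      using tilt_le[OF f(1), of 1 z "- z"] sublinear_zero[OF f(1)] by simp
    ultimately show ?thesis using sublinear_minus[OF f(1), of z] by simp
  qed
  have add: "f (x + y) = f x + f y" for x y
  proof (rule antisym)
    \<comment> \<open>By oddness, subadditivity at \<open>- x\<close> and \<open>- y\<close> is
      superadditivity at \<open>x\<close> and \<open>y\<close>.\<close>
    show "f x + f y \<le> f (x + y)"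
      using sublinear_add[OF f(1), of "- x" "- y"] neg[of "x + y"] neg[of x] neg[of y] by simp
  qed (rule sublinear_add[OF f(1)])
  have scale: "f (r *\<^sub>R x) = r * f x" for r x
  proof (cases "0 \<le> r")
    case True
    then show ?thesis by (rule sublinear_scaleR[OF f(1)])
  next
    case False
    then have "f ((- r) *\<^sub>R x) = (- r) * f x" by (intro sublinear_scaleR[OF f(1)]) simp
    then show ?thesis using neg[of "r *\<^sub>R x"] by simp
  qed
  show thesis
  proof
    show "linear f" by (rule linearI) (simp_all add: add scale)
    show "f x \<le> q x" for x using f(2) by (simp add: le_fun_def)
  qed
qed

text \<open>A linear functional below \<open>tilt q z\<close> attains \<open>q z\<close>: the
  parameter 0 gives \<open>f \<le> q\<close>, and the parameter 1 at \<open>- z\<close> gives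
  \<open>- f z \<le> - q z\<close>.\<close>

lemma Hahn_Banach_sublinear:
  assumes q: "sublinear q"
  obtains f where "linear f" "\<And>x. f x \<le> q x" "f z = q z"
proof -
  obtain f where f: "linear f" "\<And>x. f x \<le> tilt q z x"
    using sublinear_dominates_linear[OF sublinear_tilt[OF q]] by blast
  have le: "f x \<le> q x" for x
    using f(2)[of x] tilt_le[OF q, of 0 z x] by simp
  have "f (- z) \<le> - q z"
    using f(2)[of "- z"] tilt_le[OF q, of 1 z "- z"] sublinear_zero[OF q] by simp
  then have "q z \<le> f z" using linear_neg[OF f(1), of z] by simp
  with le[of z] have "f z = q z" by simp
  with f(1) le show thesis by (rule that)
qed

section \<open>Real seminorms and the functionals they dominate\<close>

locale real_seminorm =
  fixes p :: "'x::real_vector \<Rightarrow> real"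
  assumes scaleR: "p (r *\<^sub>R x) = \<bar>r\<bar> * p x"
    and triangle: "p (x + y) \<le> p x + p y"
begin

lemma zero [simp]: "p 0 = 0"
  using scaleR[of 0 0] by simp

lemma neg [simp]: "p (- x) = p x"
  using scaleR[of "-1" x] by simp

lemma commute: "p (x - y) = p (y - x)"
  using neg[of "x - y"] by simp

lemma nonneg: "0 \<le> p x"
  using triangle[of x "- x"] by simp

lemma triangle_diff: "p (x - z) \<le> p (x - y) + p (y - z)"
  using triangle[of "x - y" "y - z"] by simp

lemma sum_le: "p (\<Sum>i\<in>I. f i) \<le> (\<Sum>i\<in>I. p (f i))"
proof (induction I rule: infinite_finite_induct)
  case (insert i I)
  then show ?case using triangle[of "f i" "\<Sum>i\<in>I. f i"] by simp
qed simp_all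

lemma sublinear: "sublinear p"
  unfolding sublinear_def using triangle scaleR by simp

lemma norming_functional:
  obtains f where "linear f" "\<And>x. f x \<le> p x" "f z = p z"
  using Hahn_Banach_sublinear[OF sublinear, where z = z] by blast

text \<open>Mazur's theorem for subspaces: apply the Hahn--Banach theorem to the quotient seminorm.\<close>

lemma functional_vanishing_on_subspace:
  assumes V: "subspace V" and "0 < e" and away: "\<And>v. v \<in> V \<Longrightarrow> e \<le> p (z - v)"
  obtains f where "linear f" "\<And>x. f x \<le> p x" "\<And>v. v \<in> V \<Longrightarrow> f v = 0" "e \<le> f z"
proof -
  define d where "d x = (INF v\<in>V. p (x - v))" for x
  have V0: "0 \<in> V" using V by (rule subspace_0)
  have low: "d x \<le> p (x - v)" if "v \<in> V" for x v
    unfolding d_def using that nonneg by (intro cINF_lower) (auto intro!: bdd_belowI)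
  have great: "c \<le> d x" if "\<And>v. v \<in> V \<Longrightarrow> c \<le> p (x - v)" for c x
    unfolding d_def using that V0 by (intro cINF_greatest) auto
  have "sublinear d"
    unfolding sublinear_def
  proof (intro conjI allI impI)
    fix x y
    have "d (x + y) - p (y - w) \<le> p (x - v)" if "v \<in> V" "w \<in> V" for v w
      using low[of "v + w" "x + y"] triangle[of "x - v" "y - w"] subspace_add[OF V that]
      by (simp add: algebra_simps)
    then have "d (x + y) - p (y - w) \<le> d x" if "w \<in> V" for w
      using that by (intro great)
    then have "d (x + y) - d x \<le> d y"
      by (intro great) (simp add: algebra_simps)
    then show "d (x + y) \<le> d x + d y" by simp
  next
    fix r :: real and x
    assume r: "0 < r"
    have "d (r *\<^sub>R x) / r \<le> p (x - v)" if "v \<in> V" for v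
      using low[of "r *\<^sub>R v" "r *\<^sub>R x"] subspace_scale[OF V that] scaleR[of r "x - v"] r
      by (simp add: field_simps scaleR_diff_right)
    then have "d (r *\<^sub>R x) / r \<le> d x" by (rule great)
    then show "d (r *\<^sub>R x) \<le> r * d x" using r by (simp add: field_simps)
  qed
  then obtain f where f: "linear f" "\<And>x. f x \<le> d x" "f z = d z"
    using Hahn_Banach_sublinear[where z = z] by blast
  \<comment> \<open>The distance \<open>d\<close> is at most 0 on \<open>V\<close>, hence so is
    \<open>f\<close>; the symmetry of \<open>V\<close> then makes \<open>f\<close> vanish
    there.\<close>
  have le0: "f v \<le> 0" if "v \<in> V" for v
    using f(2)[of v] low[OF that, of v] by simp
  show thesis
  proof
    show "f x \<le> p x" for x using f(2)[of x] low[OF V0, of x] by simp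
    show "f v = 0" if "v \<in> V" for v
      using le0[OF that] le0[OF subspace_neg[OF V that]] linear_neg[OF f(1), of v] by simp
    show "e \<le> f z" using great[OF away] f(3) by simp
  qed (rule f(1))
qed

end

section \<open>Fragmentability of weakly compact sets\<close>

text \<open>Bounding the coefficients makes the combinations of a finite \<open>A\<close> totally
  bounded for a seminorm, while letting \<open>M\<close> and \<open>A\<close> grow still exhausts
  the span.\<close>

definition bounded_span :: "real \<Rightarrow> 'x::real_vector set \<Rightarrow> 'x set" where
  "bounded_span M A = {\<Sum>a\<in>A. c a *\<^sub>R a | c. \<forall>a\<in>A. \<bar>c a\<bar> \<le> M}"

lemma span_in_bounded_span:
  fixes A :: "nat \<Rightarrow> 'x::real_vector set"
  assumes "incseq A" "\<And>n. finite (A n)" "v \<in> span (\<Union>n. A n)"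
  shows "\<exists>n. v \<in> bounded_span (real n) (A n)"
proof -
  obtain t u where t: "finite t" "t \<subseteq> (\<Union>n. A n)" and v: "v = (\<Sum>a\<in>t. u a *\<^sub>R a)"
    using assms(3) unfolding span_explicit by blast
  obtain f where f: "\<And>a. a \<in> t \<Longrightarrow> a \<in> A (f a)"
    using t(2) by (metis UN_E subsetD)
  \<comment> \<open>One index dominates both the stages \<open>f a\<close> at which the generators
    appear and the sizes of their coefficients.\<close>
  define n where "n = Max (insert 0 (f ` t \<union> (\<lambda>a. nat \<lceil>\<bar>u a\<bar>\<rceil>) ` t))"
  have n: "f a \<le> n" "nat \<lceil>\<bar>u a\<bar>\<rceil> \<le> n" if "a \<in> t" for a
  proof -
    have fin: "finite (insert 0 (f ` t \<union> (\<lambda>a. nat \<lceil>\<bar>u a\<bar>\<rceil>) ` t))"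
      using t(1) by simp
    show "f a \<le> n" "nat \<lceil>\<bar>u a\<bar>\<rceil> \<le> n"
      unfolding n_def using that by (intro Max_ge[OF fin]; blast)+
  qed
  have "t \<subseteq> A n"
    using f n(1) incseqD[OF assms(1)] by blast
  moreover have "\<bar>u a\<bar> \<le> real n" if "a \<in> t" for a
    using n(2)[OF that] of_nat_ceiling[of "\<bar>u a\<bar>"] by linarith
  ultimately show ?thesis
    unfolding bounded_span_def v using assms(2)[of n] t(1)
    by (intro exI[of _ n] CollectI exI[of _ "\<lambda>a. if a \<in> t then u a else 0"])
       (auto intro!: sum.mono_neutral_cong_left)
qed

text \<open>Induction on the generators: the coefficient of the new generator \<open>b\<close> is
  rounded to a multiple of \<open>1 / m\<close>, and a net for the remaining generators is shifted
  by finitely many such multiples of \<open>b\<close>.\<close>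

lemma (in real_seminorm) bounded_span_net:
  assumes "finite A" "0 < e"
  shows "\<exists>N. finite N \<and> (\<forall>v\<in>bounded_span M A. \<exists>w\<in>N. p (v - w) < e)"
  using assms
proof (induction A arbitrary: e)
  case empty
  then show ?case by (intro exI[of _ "{0}"]) (simp add: bounded_span_def)
next
  case (insert b A)
  obtain N where N: "finite N" "\<And>v. v \<in> bounded_span M A \<Longrightarrow> \<exists>w\<in>N. p (v - w) < e / 2"
    using insert.IH[of "e / 2"] insert.prems by auto
  \<comment> \<open>Rounding a coefficient by at most \<open>1 / m\<close> moves the vector by at
    most \<open>p b / m\<close>, which has to stay below \<open>e / 2\<close>.\<close>
  obtain m :: nat where m: "2 * p b / e < m"
    using reals_Archimedean2 by blast
  then have m0: "0 < real m"
    using nonneg[of b] insert.prems by (smt (verit) divide_nonneg_pos)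
  have mb: "p b / m < e / 2"
    using m m0 insert.prems by (simp add: field_simps)
  define L where "L = \<lceil>M * m\<rceil>"
  define N' where "N' = (\<lambda>(w, k::int). w + (of_int k / m) *\<^sub>R b) ` (N \<times> {- L..L})"
  have "\<exists>w\<in>N'. p (v - w) < e" if v: "v \<in> bounded_span M (insert b A)" for v
  proof -
    obtain c where c: "\<And>a. a \<in> insert b A \<Longrightarrow> \<bar>c a\<bar> \<le> M"
        and v: "v = c b *\<^sub>R b + (\<Sum>a\<in>A. c a *\<^sub>R a)"
      using v insert.hyps unfolding bounded_span_def by auto
    have "(\<Sum>a\<in>A. c a *\<^sub>R a) \<in> bounded_span M A"
      using c unfolding bounded_span_def by blast
    then obtain w where w: "w \<in> N" "p ((\<Sum>a\<in>A. c a *\<^sub>R a) - w) < e / 2"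
      using N(2) by blast
    define k where "k = \<lfloor>c b * m\<rfloor>"
    have "\<bar>c b * m\<bar> \<le> M * m"
      using c[of b] m0 by (simp add: abs_mult)
    then have k: "- L \<le> k" "k \<le> L"
      unfolding L_def k_def by linarith+
    have "\<bar>c b * m - of_int k\<bar> \<le> 1"
      unfolding k_def by linarith
    then have "\<bar>c b - of_int k / m\<bar> \<le> 1 / m"
      using m0 by (simp add: field_simps abs_le_iff)
    then have "p ((c b - of_int k / m) *\<^sub>R b) \<le> p b / m"
      unfolding scaleR using mult_right_mono[OF _ nonneg[of b]] by fastforce
    moreover have "v - (w + (of_int k / m) *\<^sub>R b)
        = ((\<Sum>a\<in>A. c a *\<^sub>R a) - w) + (c b - of_int k / m) *\<^sub>R b"
      unfolding v by (simp add: algebra_simps)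
    ultimately have "p (v - (w + (of_int k / m) *\<^sub>R b)) < e / 2 + e / 2"
      using w(2) mb triangle[of "(\<Sum>a\<in>A. c a *\<^sub>R a) - w" "(c b - of_int k / m) *\<^sub>R b"]
      by (simp only:)
    then have "p (v - (w + (of_int k / m) *\<^sub>R b)) < e" by simp
    moreover have "w + (of_int k / m) *\<^sub>R b \<in> N'"
      unfolding N'_def using w(1) k by force
    ultimately show ?thesis by blast
  qed
  moreover have "finite N'"
    unfolding N'_def using N(1) by simp
  ultimately show ?case by blast
qed

text \<open>\<open>T\<close> stands for the weak topology on a weakly compact set; its link with the
  vector space structure is the continuity of the real functionals dominated by
  \<open>p\<close>.\<close>

locale weakly_compact_seminorm = real_seminorm p for p :: "'x::real_vector \<Rightarrow> real" +
  fixes T :: "'x topology"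
  assumes compact_T: "compact_space T"
    and Hausdorff_T: "Hausdorff_space T"
    and functional_continuous:
      "linear f \<Longrightarrow> (\<And>x. f x \<le> p x) \<Longrightarrow> continuous_map T euclideanreal f"
begin

text \<open>By Hahn-Banach, \<open>p\<close> is a supremum of functionals continuous for
  \<open>T\<close>, hence lower semicontinuous for \<open>T\<close>.\<close>

lemma openin_away: "openin T {x \<in> topspace T. r < p (x - y)}"
proof (subst openin_subopen, intro ballI)
  fix x assume x: "x \<in> {x \<in> topspace T. r < p (x - y)}"
  obtain f where f: "linear f" "\<And>v. f v \<le> p v" "f (x - y) = p (x - y)"
    using norming_functional[of "x - y"] by blast
  show "\<exists>U. openin T U \<and> x \<in> U \<and> U \<subseteq> {x \<in> topspace T. r < p (x - y)}"
  proof (intro exI conjI)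
    show "openin T {w \<in> topspace T. f w \<in> {f y + r<..}}"
      using functional_continuous[OF f(1,2)] by (rule openin_continuous_map_preimage) simp
    show "x \<in> {w \<in> topspace T. f w \<in> {f y + r<..}}"
      using x f(3) by (simp add: linear_diff[OF f(1)])
    show "{w \<in> topspace T. f w \<in> {f y + r<..}} \<subseteq> {x \<in> topspace T. r < p (x - y)}"
    proof
      fix w assume "w \<in> {w \<in> topspace T. f w \<in> {f y + r<..}}"
      then show "w \<in> {x \<in> topspace T. r < p (x - y)}"
        using f(2)[of "w - y"] by (simp add: linear_diff[OF f(1)])
    qed
  qed
qed

lemma closedin_cball: "closedin T {x \<in> topspace T. p (x - y) \<le> r}"
proof -
  have "{x \<in> topspace T. p (x - y) \<le> r} = topspace T - {x \<in> topspace T. r < p (x - y)}"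
    by auto
  then show ?thesis using openin_away[of r y] by auto
qed

lemma openin_away_finite:
  assumes "finite N"
  shows "openin T {x \<in> topspace T. \<forall>w\<in>N. r < p (x - w)}"
  using assms
proof induction
  case (insert w N)
  have "{x \<in> topspace T. \<forall>w\<in>insert w N. r < p (x - w)} =
      {x \<in> topspace T. r < p (x - w)} \<inter> {x \<in> topspace T. \<forall>w\<in>N. r < p (x - w)}"
    by auto
  then show ?case using insert openin_away by auto
qed simp

text \<open>
  Otherwise there are points \<open>y n\<close> in shrinking open sets such that \<open>y\<close> has a cluster point at
  distance at least \<open>e\<close> from the span of the \<open>y n\<close>, contradicting Mazur's theorem. The states of
  the recursion are pairs of the current open set and the finite set of points chosen so far.
\<close>

lemma finitely_covered_open_set:
  assumes "0 < e" "topspace T \<noteq> {}"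
  shows "\<exists>U N. openin T U \<and> U \<noteq> {} \<and> finite N \<and> (\<forall>x\<in>U. \<exists>w\<in>N. p (x - w) \<le> 2 * e)"
proof (rule ccontr)
  assume neg: "\<not> ?thesis"
  \<comment> \<open>One stage of the recursion. The closed set \<open>C\<close> between
    \<open>V\<close> and \<open>U\<close> comes from regularity and allows compactness to be applied
    to the nested sets later.\<close>
  have step: "\<exists>V C y. openin T V \<and> closedin T C \<and> y \<in> V \<and> V \<subseteq> C \<and> C \<subseteq> U \<and>
      (\<forall>x\<in>C. \<forall>v\<in>bounded_span M A. e < p (x - v))"
    if U: "openin T U" "U \<noteq> {}" and A: "finite A" for U A M
  proof -
    obtain N where N: "finite N" "\<And>v. v \<in> bounded_span M A \<Longrightarrow> \<exists>w\<in>N. p (v - w) < e"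
      using bounded_span_net[OF A assms(1), of M] by (elim exE conjE) blast
    \<comment> \<open>A point more than \<open>2 * e\<close> away from each point of the
      \<open>e\<close>-net \<open>N\<close> is more than \<open>e\<close> away from the whole
      bounded span; finiteness of \<open>N\<close> keeps this condition open.\<close>
    let ?W = "U \<inter> {x \<in> topspace T. \<forall>w\<in>N. 2 * e < p (x - w)}"
    have "\<exists>y\<in>U. \<forall>w\<in>N. 2 * e < p (y - w)"
    proof (rule ccontr)
      assume "\<not> ?thesis"
      then have "\<forall>x\<in>U. \<exists>w\<in>N. p (x - w) \<le> 2 * e"
        by (simp add: not_less)
      with neg U N(1) show False by blast
    qed
    then obtain y where y: "y \<in> ?W"
      using openin_subset[OF U(1)] by blast
    have W: "openin T ?W"
      by (rule openin_Int[OF U(1) openin_away_finite[OF N(1)]])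
    have "regular_space T"
      using compact_Hausdorff_imp_regular_space[OF compact_T Hausdorff_T] .
    then obtain V C where VC: "openin T V" "closedin T C" "y \<in> V" "V \<subseteq> C" "C \<subseteq> ?W"
      unfolding neighbourhood_base_of_closedin[symmetric] neighbourhood_base_of
      using W y by (elim allE[of _ ?W] allE[of _ y]) blast
    have "e < p (x - v)" if "x \<in> C" "v \<in> bounded_span M A" for x v
    proof -
      obtain w where "w \<in> N" "p (v - w) < e" using N(2)[OF \<open>v \<in> _\<close>] by blast
      moreover have "2 * e < p (x - w)" using VC(5) \<open>x \<in> C\<close> \<open>w \<in> N\<close> by blast
      ultimately show ?thesis using triangle_diff[of x w v] by simp
    qed
    then show ?thesis using VC by blast
  qed
  define good where "good s \<longleftrightarrow> openin T (fst s) \<and> fst s \<noteq> {} \<and> finite (snd s)"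
    for s :: "'x set \<times> 'x set"
  \<comment> \<open>The coefficient bound grows with the stage \<open>n\<close>, so that the bounded
    spans exhaust the span of all chosen points.\<close>
  define next_to where "next_to n s s' \<longleftrightarrow>
      (\<exists>C y. closedin T C \<and> y \<in> fst s' \<and> fst s' \<subseteq> C \<and> C \<subseteq> fst s \<and> snd s' = insert y (snd s) \<and>
        (\<forall>x\<in>C. \<forall>v\<in>bounded_span (real n) (snd s). e < p (x - v)))"
    for n and s s' :: "'x set \<times> 'x set"
  have "\<exists>s. \<forall>n. good (s n) \<and> next_to n (s n) (s (Suc n))"
  proof (rule dependent_nat_choice)
    show "\<exists>s. good s"
      using assms(2) by (intro exI[of _ "(topspace T, {})"]) (simp add: good_def)
  next
    fix s n assume s: "good s"
    obtain V C y where "openin T V" "closedin T C" "y \<in> V" "V \<subseteq> C" "C \<subseteq> fst s"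
        "\<forall>x\<in>C. \<forall>v\<in>bounded_span (real n) (snd s). e < p (x - v)"
      using step[of "fst s" "snd s" "real n"] s unfolding good_def by blast
    then show "\<exists>s'. good s' \<and> next_to n s s'"
      using s by (intro exI[of _ "(V, insert y (snd s))"]) (auto simp: good_def next_to_def)
  qed
  then obtain s where s: "\<And>n. good (s n)" "\<And>n. next_to n (s n) (s (Suc n))"
    by blast
  define U where "U n = fst (s n)" for n
  define A where "A n = snd (s n)" for n
  have UA: "openin T (U n)" "U n \<noteq> {}" "finite (A n)" for n
    using s(1)[of n] unfolding good_def U_def A_def by blast+
  have "\<forall>n. \<exists>C y. closedin T C \<and> y \<in> U (Suc n) \<and> U (Suc n) \<subseteq> C \<and> C \<subseteq> U n \<and>
        A (Suc n) = insert y (A n) \<and> (\<forall>x\<in>C. \<forall>v\<in>bounded_span (real n) (A n). e < p (x - v))"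
    using s(2) unfolding next_to_def U_def A_def by blast
  then obtain C y where "\<forall>n. closedin T (C n) \<and> y n \<in> U (Suc n) \<and> U (Suc n) \<subseteq> C n \<and> C n \<subseteq> U n \<and>
        A (Suc n) = insert (y n) (A n) \<and>
        (\<forall>x\<in>C n. \<forall>v\<in>bounded_span (real n) (A n). e < p (x - v))"
    unfolding choice_iff by blast
  then have C: "\<And>n. closedin T (C n)" "\<And>n. U (Suc n) \<subseteq> C n" "\<And>n. C n \<subseteq> U n"
      and y: "\<And>n. y n \<in> U (Suc n)" and A: "\<And>n. A (Suc n) = insert (y n) (A n)"
      and far: "\<And>n x v. x \<in> C n \<Longrightarrow> v \<in> bounded_span (real n) (A n) \<Longrightarrow> e < p (x - v)"
    by simp_all
  define V where "V = span (\<Union>n. A n)"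
  have yV: "y n \<in> V" for n
    unfolding V_def using A[of n] by (intro span_base) blast
  \<comment> \<open>A point of this intersection lies in the closure of the chosen points and yet,
    being in every \<open>C n\<close>, far from every bounded span.\<close>
  have "(\<Inter>n. C n \<inter> T closure_of range y) \<noteq> {}"
  proof (rule compact_space_imp_nest[OF compact_T])
    show "closedin T (C n \<inter> T closure_of range y)" for n
      using C(1) by (intro closedin_Int closedin_closure_of)
    have "range y \<subseteq> topspace T"
      using y openin_subset[OF UA(1)] by blast
    then show "C n \<inter> T closure_of range y \<noteq> {}" for n
      using y[of n] C(2)[of n] closure_of_subset[of "range y" T] by blast
    have "C (Suc n) \<subseteq> C n" for n
      using C(2)[of n] C(3)[of "Suc n"] by blast
    then show "decseq (\<lambda>n. C n \<inter> T closure_of range y)"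
      by (intro decseq_SucI) blast
  qed
  then obtain z where z: "\<And>n. z \<in> C n" "z \<in> T closure_of range y" by blast
  \<comment> \<open>Otherwise a functional continuous for \<open>T\<close> vanishes at all
    \<open>y n\<close> but is at least \<open>e\<close> at \<open>z\<close>, although
    \<open>z\<close> lies in their closure.\<close>
  have "\<exists>v\<in>V. p (z - v) < e"
  proof (rule ccontr)
    assume "\<not> ?thesis"
    then obtain f where f: "linear f" "\<And>x. f x \<le> p x" "\<And>v. v \<in> V \<Longrightarrow> f v = 0" "e \<le> f z"
      using functional_vanishing_on_subspace[OF _ assms(1), of V z] subspace_span
      unfolding V_def by (metis not_le)
    have "closedin T {x \<in> topspace T. f x \<in> {0}}"
      using functional_continuous[OF f(1,2)] by (rule closedin_continuous_map_preimage) simp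
    moreover have "range y \<subseteq> {x \<in> topspace T. f x \<in> {0}}"
      using yV f(3) y openin_subset[OF UA(1)] by blast
    ultimately have "T closure_of range y \<subseteq> {x \<in> topspace T. f x \<in> {0}}"
      by (rule closure_of_minimal[rotated])
    then show False using z(2) f(4) assms(1) by auto
  qed
  then obtain v where v: "v \<in> V" "p (z - v) < e" by blast
  have "incseq A" using A by (intro incseq_SucI) blast
  then obtain n where "v \<in> bounded_span (real n) (A n)"
    using span_in_bounded_span UA(3) v(1) unfolding V_def by blast
  then show False using far[OF z(1)] v(2) by force
qed

text \<open>Induction on the centres of a finite cover by balls: either \<open>U\<close> lies in the
  ball around \<open>w\<close>, or removing this closed ball leaves a nonempty open set covered by
  the other balls.\<close>

lemma small_open_set:
  assumes "0 < e" "topspace T \<noteq> {}"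
  obtains U where "openin T U" "U \<noteq> {}" "\<And>x y. x \<in> U \<Longrightarrow> y \<in> U \<Longrightarrow> p (x - y) \<le> e"
proof -
  have "\<exists>V w. openin T V \<and> V \<noteq> {} \<and> (\<forall>x\<in>V. p (x - w) \<le> r)"
    if "finite N" "openin T U" "U \<noteq> {}" "\<forall>x\<in>U. \<exists>w\<in>N. p (x - w) \<le> r" for U N r
    using that
  proof (induction N arbitrary: U)
    case (insert w N)
    let ?V = "U \<inter> {x \<in> topspace T. r < p (x - w)}"
    show ?case
    proof (cases "?V = {}")
      case True
      then show ?thesis
        using insert.prems openin_subset[of T U] by (intro exI[of _ U] exI[of _ w]) force
    next
      case False
      show ?thesis
      proof (rule insert.IH[of ?V])
        show "openin T ?V" using insert.prems(1) openin_away by (rule openin_Int)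
        show "\<forall>x\<in>?V. \<exists>w\<in>N. p (x - w) \<le> r" using insert.prems(3) by force
      qed (rule False)
    qed
  qed auto
  then obtain V w where V: "openin T V" "V \<noteq> {}" "\<And>x. x \<in> V \<Longrightarrow> p (x - w) \<le> 2 * (e / 4)"
    using finitely_covered_open_set[of "e / 4"] assms by (metis zero_less_divide_iff zero_less_numeral)
  have "p (x - y) \<le> e" if "x \<in> V" "y \<in> V" for x y
    using triangle_diff[of x y w] V(3)[OF that(1)] V(3)[OF that(2)] commute[of w y] by simp
  then show thesis using V that by blast
qed

end

section \<open>The weak topology\<close>

lemma real_seminormI:
  fixes scal :: "'k::real_normed_field \<Rightarrow> 'x::real_vector \<Rightarrow> 'x"
  assumes "seminorm_on_space scal p" "\<And>r x. scal (of_real r) x = r *\<^sub>R x"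
  shows "real_seminorm p"
proof
  fix r x y
  show "p (r *\<^sub>R x) = \<bar>r\<bar> * p x"
    using assms(1) unfolding seminorm_on_space_def assms(2)[symmetric] by simp
  show "p (x + y) \<le> p x + p y"
    using assms(1) unfolding seminorm_on_space_def by blast
qed

text \<open>
  The form \<open>(c, d) \<mapsto> (c * d) \<bullet> 1\<close> on the scalar field is nondegenerate, so that a real
  functional \<open>f\<close> determines a scalar-valued one by \<open>(F x * d) \<bullet> 1 = f (scal d x)\<close>. For the
  complex numbers this is the formula \<open>F x = f x - \<i> * f (scal \<i> x)\<close>.
\<close>

lemma real_functional_lift:
  fixes scal :: "'k::{real_normed_field,euclidean_space} \<Rightarrow> 'x::real_vector \<Rightarrow> 'x"
  assumes vs: "vector_space scal" and compat: "\<And>r x. scal (of_real r) x = r *\<^sub>R x"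
    and p: "seminorm_on_space scal p" and f: "linear f" "\<And>x. f x \<le> p x"
  obtains F M where "Vector_Spaces.linear scal (*) F" "\<And>x. F x \<bullet> 1 = f x"
    "\<And>x. norm (F x) \<le> M * p x" "0 < M"
proof -
  interpret vector_space scal by (rule vs)
  interpret real_seminorm p by (rule real_seminormI[OF p compat])
  have scal_Basis: "scal (r *\<^sub>R b) x = r *\<^sub>R scal b x" for r b x
    by (simp add: scaleR_conv_of_real compat flip: scale_scale)
  \<comment> \<open>\<open>G c\<close> is the vector whose inner products with the basis are the
    values of \<open>d \<mapsto> (c * d) \<bullet> 1\<close>; inverting \<open>G\<close> turns a
    real functional on the scalar field into a scalar.\<close>
  define G :: "'k \<Rightarrow> 'k" where "G c = (\<Sum>b\<in>Basis. ((c * b) \<bullet> 1) *\<^sub>R b)" for c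
  have G: "linear G"
    by (rule linearI)
       (simp_all add: G_def algebra_simps inner_add_left sum.distrib scaleR_sum_right)
  have G_inner: "G c \<bullet> b = (c * b) \<bullet> 1" if "b \<in> Basis" for b c
    unfolding G_def using that by (simp add: inner_sum_left inner_Basis if_distrib sum.If_cases)
  have ext: "c = c'" if "\<And>d. (c * d) \<bullet> 1 = (c' * d) \<bullet> 1" for c c' :: 'k
  proof (rule ccontr)
    assume "c \<noteq> c'"
    then have "(1::'k) \<bullet> 1 = ((c - c') * inverse (c - c')) \<bullet> 1" by simp
    also have "\<dots> = 0"
      using that[of "inverse (c - c')"] by (simp add: left_diff_distrib inner_diff_left)
    finally show False by simp
  qed
  have expand: "h d = (\<Sum>b\<in>Basis. (d \<bullet> b) * h b)" if "linear h" for h :: "'k \<Rightarrow> real" and d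
    by (subst (1) euclidean_representation[of d, symmetric])
       (simp add: linear_sum[OF that] linear_scale[OF that])
  have lin_mult: "linear (\<lambda>d. (c * d) \<bullet> 1)" for c :: 'k
    by (rule linearI) (simp_all add: algebra_simps inner_add_left)
  have lin_scal: "linear (\<lambda>d. f (scal d x))" for x
    by (rule linearI)
       (simp_all add: scale_left_distrib linear_add[OF f(1)] scal_Basis linear_scale[OF f(1)])
  have "inj G"
  proof (rule injI)
    fix c c' assume eq: "G c = G c'"
    show "c = c'"
    proof (rule ext)
      fix d
      show "(c * d) \<bullet> 1 = (c' * d) \<bullet> 1"
        by (subst (1 2) expand[OF lin_mult]) (simp add: G_inner[symmetric] eq)
    qed
  qed
  then have "surj G" using linear_injective_imp_surjective[OF G] by blast
  define F where "F x = inv G (\<Sum>b\<in>Basis. f (scal b x) *\<^sub>R b)" for x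
  have GF: "G (F x) = (\<Sum>b\<in>Basis. f (scal b x) *\<^sub>R b)" for x
    unfolding F_def by (rule surj_f_inv_f[OF \<open>surj G\<close>])
  have F: "(F x * d) \<bullet> 1 = f (scal d x)" for x d
  proof -
    have "(F x * b) \<bullet> 1 = f (scal b x)" if "b \<in> Basis" for b
      using that unfolding G_inner[OF that, symmetric] GF
      by (simp add: inner_sum_left inner_Basis if_distrib sum.If_cases)
    then show ?thesis
      by (subst expand[OF lin_mult], subst expand[OF lin_scal]) simp
  qed
  \<comment> \<open>An injective linear map in finite dimension is bounded below, which carries a
    bound on \<open>G (F x)\<close> over to \<open>F x\<close>.\<close>
  obtain B where B: "0 < B" "\<And>c. B * norm c \<le> norm (G c)"
    using linear_inj_bounded_below_pos[OF G \<open>inj G\<close>] by (metis mult.commute)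
  have abs_f: "\<bar>f x\<bar> \<le> p x" for x
    using f(2)[of x] f(2)[of "- x"] linear_neg[OF f(1), of x] by simp
  have bound: "norm (F x) \<le> DIM('k) / B * p x" for x
  proof -
    have "norm (G (F x)) \<le> (\<Sum>b\<in>Basis. norm (f (scal b x) *\<^sub>R b))"
      unfolding GF by (rule norm_sum)
    also have "\<dots> \<le> (\<Sum>b\<in>(Basis::'k set). p x)"
    proof (rule sum_mono)
      fix b :: 'k assume "b \<in> Basis"
      then show "norm (f (scal b x) *\<^sub>R b) \<le> p x"
        using abs_f[of "scal b x"] p by (simp add: seminorm_on_space_def)
    qed
    finally have "B * norm (F x) \<le> DIM('k) * p x"
      using B(2)[of "F x"] by simp
    then show ?thesis using B(1) by (simp add: field_simps)
  qed
  have add: "F (x + y) = F x + F y" for x y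
    by (rule ext) (simp add: F distrib_right inner_add_left scale_right_distrib linear_add[OF f(1)])
  have scale: "F (scal c x) = c * F x" for c x
  proof (rule ext)
    fix d
    show "(F (scal c x) * d) \<bullet> 1 = (c * F x * d) \<bullet> 1"
      using F[of "scal c x" d] F[of x "d * c"] by (simp add: mult_ac)
  qed
  show thesis
  proof
    show "Vector_Spaces.linear scal (*) F"
      unfolding Vector_Spaces.linear_def module_hom_def module_hom_axioms_def
      using vs vector_space_over_itself.vector_space_axioms add scale
      by (auto simp: vector_space_def module_def algebra_simps)
    show "F x \<bullet> 1 = f x" for x using F[of x 1] by simp
    show "norm (F x) \<le> DIM('k) / B * p x" for x by (rule bound)
    show "0 < DIM('k) / B" using B(1) by simp
  qed
qed

lemma topspace_seminorm_topology [simp]: "topspace (seminorm_topology Q) = UNIV"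
  by (auto simp: seminorm_topology_def topology_generated_by_topspace)

lemma continuous_map_seminorm_topology:
  fixes F :: "'x::real_vector \<Rightarrow> 'b::real_normed_vector"
  assumes "p \<in> Q" "0 < M" and F: "\<And>x y. norm (F x - F y) \<le> M * p (x - y)"
    and p0: "p 0 = 0"
  shows "continuous_map (seminorm_topology Q) euclidean F"
  unfolding continuous_map_def
proof (intro conjI allI impI)
  fix U :: "'b set" assume "openin euclidean U"
  then have U: "open U" by simp
  show "openin (seminorm_topology Q) {x \<in> topspace (seminorm_topology Q). F x \<in> U}"
  proof (subst openin_subopen, intro ballI)
    fix x assume "x \<in> {x \<in> topspace (seminorm_topology Q). F x \<in> U}"
    then obtain e where e: "0 < e" "\<And>c. dist c (F x) < e \<Longrightarrow> c \<in> U"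
      using U unfolding open_dist by blast
    have "F y \<in> U" if "p (y - x) < e / M" for y
    proof (rule e(2))
      have "M * p (y - x) < e" using that assms(2) by (simp add: field_simps)
      then show "dist (F y) (F x) < e" using F[of y x] by (simp add: dist_norm)
    qed
    moreover have "openin (seminorm_topology Q) {y. p (y - x) < e / M}"
      unfolding seminorm_topology_def
    proof (rule topology_generated_by_Basis, rule insertI2)
      show "{y. p (y - x) < e / M} \<in> {{y. p (y - x) < r} | p x r. p \<in> Q \<and> 0 < r}"
        using assms(1,2) e(1) by (intro CollectI exI[of _ p] exI[of _ x] exI[of _ "e / M"]) simp
    qed
    moreover have "x \<in> {y. p (y - x) < e / M}" using e(1) assms(2) p0 by simp
    ultimately show "\<exists>V. openin (seminorm_topology Q) V \<and> x \<in> V \<and>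
        V \<subseteq> {x \<in> topspace (seminorm_topology Q). F x \<in> U}"
      by (intro exI[of _ "{y. p (y - x) < e / M}"]) auto
  qed
qed simp

text \<open>The weak topology is generated by scalar-valued functionals; the real functional
  \<open>f\<close> is recovered as \<open>F x \<bullet> 1\<close> from a lift
  \<open>F\<close>.\<close>

lemma continuous_map_weak_topology:
  fixes scal :: "'k::{real_normed_field,euclidean_space} \<Rightarrow> 'x::real_vector \<Rightarrow> 'x"
  assumes lcs: "locally_convex_space scal Q" and p: "p \<in> Q"
    and f: "linear f" "\<And>x. f x \<le> p x"
  shows "continuous_map (weak_topology scal (seminorm_topology Q)) euclideanreal f"
proof -
  have vs: "vector_space scal" and compat: "\<And>r x. scal (of_real r) x = r *\<^sub>R x"
      and sp: "seminorm_on_space scal p"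
    using lcs p unfolding locally_convex_space_def by blast+
  interpret real_seminorm p by (rule real_seminormI[OF sp compat])
  obtain F M where F: "Vector_Spaces.linear scal (*) F" "\<And>x. F x \<bullet> 1 = f x"
      "\<And>x. norm (F x) \<le> M * p x" "0 < M"
    using real_functional_lift[OF vs compat sp f] by blast
  interpret F: Vector_Spaces.linear scal "(*)" F by (rule F(1))
  have cont: "continuous_map (seminorm_topology Q) euclidean F"
    using p F(4) by (rule continuous_map_seminorm_topology) (auto simp: F(3) simp flip: F.diff)
  have basic: "openin (weak_topology scal (seminorm_topology Q)) (F -` U)" if "open U" for U
    unfolding weak_topology_def using F(1) cont that by (intro topology_generated_by_Basis) blast
  show ?thesis
    unfolding continuous_map_def
  proof (intro conjI allI impI)
    fix V assume "openin euclideanreal V"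
    then have "open ((\<lambda>c. c \<bullet> 1) -` V :: 'k set)"
      by (intro open_vimage) (auto intro!: continuous_intros)
    moreover have "{x \<in> topspace (weak_topology scal (seminorm_topology Q)). f x \<in> V}
        = F -` ((\<lambda>c. c \<bullet> 1) -` V)"
      using openin_subset[OF basic[OF open_UNIV]] by (auto simp: F(2))
    ultimately show "openin (weak_topology scal (seminorm_topology Q))
        {x \<in> topspace (weak_topology scal (seminorm_topology Q)). f x \<in> V}"
      using basic by simp
  qed simp
qed

lemma seminorms_separate:
  fixes Q :: "('x::real_vector \<Rightarrow> real) set"
  assumes Q: "\<And>p. p \<in> Q \<Longrightarrow> real_seminorm p" and "Hausdorff_space (seminorm_topology Q)" "x \<noteq> y"
  shows "\<exists>p\<in>Q. 0 < p (x - y)"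
proof (rule ccontr)
  assume none: "\<not> ?thesis"
  have null: "p (x - y) = 0" if "p \<in> Q" for p
  proof -
    interpret real_seminorm p using Q[OF that] .
    show ?thesis using none that nonneg[of "x - y"] by force
  qed
  \<comment> \<open>Being indistinguishable by seminorms passes from the generating balls to all
    open sets, which contradicts the Hausdorff property.\<close>
  have inseparable: "x \<in> U \<longleftrightarrow> y \<in> U" if "openin (seminorm_topology Q) U" for U
    using openin_topology_generated_by[OF that[unfolded seminorm_topology_def]]
  proof induction
    case (Basis s)
    show ?case
    proof (cases "s = UNIV")
      case False
      then obtain p z r where s: "s = {y. p (y - z) < r}" and p: "p \<in> Q"
        using Basis by blast
      interpret real_seminorm p using Q[OF p] .
      have "p (x - z) = p (y - z)"
        using triangle_diff[of x z y] triangle_diff[of y z x] null[OF p] commute[of x y] by simp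
      then show ?thesis by (simp add: s)
    qed simp
  qed auto
  then show False
    using assms(2,3) unfolding Hausdorff_space_def by (auto simp: disjnt_iff) blast
qed

text \<open>Some seminorm is positive at \<open>x - y\<close>; a functional norming
  \<open>x - y\<close> for it separates the points by two open half-spaces.\<close>

lemma Hausdorff_weak_topology:
  fixes scal :: "'k::{real_normed_field,euclidean_space} \<Rightarrow> 'x::real_vector \<Rightarrow> 'x"
  assumes lcs: "locally_convex_space scal Q"
  shows "Hausdorff_space (weak_topology scal (seminorm_topology Q))"
  unfolding Hausdorff_space_def
proof (intro allI impI, elim conjE)
  let ?W = "weak_topology scal (seminorm_topology Q)"
  fix x y assume xy: "x \<in> topspace ?W" "y \<in> topspace ?W" "x \<noteq> y"
  have sem: "real_seminorm p" if "p \<in> Q" for p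
    using lcs that unfolding locally_convex_space_def by (blast intro: real_seminormI)
  obtain p where p: "p \<in> Q" "0 < p (x - y)"
    using seminorms_separate[OF sem _ xy(3)] lcs unfolding locally_convex_space_def by blast
  obtain f where f: "linear f" "\<And>v. f v \<le> p v" "f (x - y) = p (x - y)"
    using real_seminorm.norming_functional[OF sem[OF p(1)]] by blast
  then have "f y < f x" using p(2) by (simp add: linear_diff)
  then obtain m where m: "f y < m" "m < f x" using dense by blast
  have cont: "continuous_map ?W euclideanreal f"
    by (rule continuous_map_weak_topology[OF lcs p(1) f(1,2)])
  show "\<exists>U V. openin ?W U \<and> openin ?W V \<and> x \<in> U \<and> y \<in> V \<and> disjnt U V"
  proof (intro exI conjI)
    show "openin ?W {z \<in> topspace ?W. f z \<in> {m<..}}" "openin ?W {z \<in> topspace ?W. f z \<in> {..<m}}"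
      by (rule openin_continuous_map_preimage[OF cont]; simp)+
  qed (use xy m in \<open>auto simp: disjnt_iff\<close>)
qed

section \<open>Means on orbit functions\<close>

lemma sup_norm_bounds:
  assumes "f \<in> bcontfun"
  shows "norm (f t) \<le> sup_norm f" "0 \<le> sup_norm f"
proof -
  have "bounded (range f)" using assms by (simp add: bcontfun_def)
  then have "bdd_above (range (\<lambda>s. norm (f s)))"
    unfolding bounded_iff by (auto intro: bdd_aboveI)
  then show *: "norm (f t) \<le> sup_norm f" for t
    unfolding sup_norm_def by (intro cSUP_upper) auto
  show "0 \<le> sup_norm f" using *[of undefined] norm_ge_zero order_trans by blast
qed

lemma sup_norm_le: "(\<And>s. norm (f s) \<le> c) \<Longrightarrow> sup_norm f \<le> c"
  unfolding sup_norm_def by (rule cSUP_least) auto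

text \<open>\<open>dual_norm\<close> is a supremum of reals and bounds the values only once they are
  known to be bounded. The constant \<open>B\<close> of \<open>dual_space\<close> provides this, in
  absolute value because its sign is unspecified.\<close>

lemma mean_on_contractive:
  assumes mean: "mean_on Y \<mu>" and Y: "Y \<subseteq> bcontfun" and f: "f \<in> Y" "\<And>s. norm (f s) \<le> 1"
  shows "norm (\<mu> f) \<le> 1"
proof -
  obtain B where B: "\<And>g. g \<in> Y \<Longrightarrow> norm (\<mu> g) \<le> B * sup_norm g"
    using mean unfolding mean_on_def dual_space_def by blast
  have "norm (\<mu> g) \<le> \<bar>B\<bar>" if "g \<in> Y" "sup_norm g \<le> 1" for g
  proof -
    have "0 \<le> sup_norm g" using sup_norm_bounds(2) that(1) Y by blast
    then have "\<bar>B\<bar> * sup_norm g \<le> \<bar>B\<bar>" "B * sup_norm g \<le> \<bar>B\<bar> * sup_norm g"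
      using that(2) by (auto intro: mult_left_le mult_right_mono)
    then show ?thesis using B[OF that(1)] by simp
  qed
  then have "bdd_above ((\<lambda>g. norm (\<mu> g)) ` {g\<in>Y. sup_norm g \<le> 1})"
    by (intro bdd_aboveI2[of _ _ "\<bar>B\<bar>"]) simp
  then have "norm (\<mu> f) \<le> dual_norm Y \<mu>"
    unfolding dual_norm_def using f by (intro cSUP_upper) (auto intro: sup_norm_le)
  then show ?thesis using mean by (simp add: mean_on_def)
qed

text \<open>Evaluations serve to show that the sets generating
  \<open>multiplicative_mean_topology\<close> cover \<open>bcontfun\<close>. The norm is attained at
  the constant function 1.\<close>

lemma multiplicative_mean_evaluation: "multiplicative_mean (\<lambda>f. f t)"
proof -
  have "(SUP f\<in>{f\<in>bcontfun. sup_norm f \<le> 1}. norm (f t :: complex)) = 1"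
  proof (rule cSup_eq_maximum)
    have "sup_norm (\<lambda>_::'a. 1) \<le> 1" by (rule sup_norm_le) simp
    then show "1 \<in> (\<lambda>f. norm (f t)) ` {f\<in>bcontfun. sup_norm f \<le> 1}"
      using const_bcontfun[of "1::complex"] by (intro image_eqI[of _ _ "\<lambda>_. 1"]) auto
  next
    fix c assume "c \<in> (\<lambda>f. norm (f t)) ` {f\<in>bcontfun. sup_norm f \<le> 1}"
    then show "c \<le> 1" using sup_norm_bounds(1) order_trans by blast
  qed
  moreover have "\<exists>B. \<forall>f\<in>bcontfun. norm (f t :: complex) \<le> B * sup_norm f"
    using sup_norm_bounds(1) by (intro exI[of _ 1]) auto
  ultimately show ?thesis
    unfolding multiplicative_mean_def mean_on_def dual_space_def dual_norm_def by simp
qed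

section \<open>Compact systems and their orbit functions\<close>

locale compact_system =
  fixes T :: "'x topology" and act :: "'s::semitopological_semigroup \<Rightarrow> 'x \<Rightarrow> 'x"
  assumes compact_T: "compact_space T"
    and system: "dynamical_system T act"
begin

lemma act_act: "x \<in> topspace T \<Longrightarrow> act s (act t x) = act (s * t) x"
  using system by (simp add: dynamical_system_def)

lemma orbit_continuous: "x \<in> topspace T \<Longrightarrow> continuous_map euclidean T (\<lambda>s. act s x)"
  using system by (simp add: dynamical_system_def)

lemma act_continuous: "continuous_map T T (act s)"
  using system by (simp add: dynamical_system_def)

lemma act_in_topspace: "x \<in> topspace T \<Longrightarrow> act s x \<in> topspace T"
  using act_continuous[of s] by (auto simp: continuous_map_def)

lemma continuous_map_act:
  "continuous_map T euclideanreal f \<Longrightarrow> continuous_map T euclideanreal (\<lambda>x. f (act s x))"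
  using continuous_map_compose[OF act_continuous] by (simp add: o_def)

lemma continuous_bounded:
  assumes "continuous_map T euclideanreal f"
  obtains B where "0 < B" "\<And>x. x \<in> topspace T \<Longrightarrow> \<bar>f x\<bar> \<le> B"
proof -
  have "compact (f ` topspace T)"
    using image_compactin[OF _ assms] compact_T by (simp add: compact_space_def)
  then have "bounded (f ` topspace T)" by (rule compact_imp_bounded)
  then obtain B where "0 < B" "\<forall>c\<in>f ` topspace T. norm c \<le> B"
    using bounded_pos by blast
  then show thesis using that by simp
qed

text \<open>For nonnegative functions without a common zero, this compactness argument yields a
  finite sum that is strictly positive everywhere.\<close>

lemma finite_positive_family:
  assumes g: "\<And>i. i \<in> C \<Longrightarrow> continuous_map T euclideanreal (g i)"
    and pos: "\<And>x. x \<in> topspace T \<Longrightarrow> \<exists>i\<in>C. 0 < g i x"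
  shows "\<exists>I. finite I \<and> I \<subseteq> C \<and> (\<forall>x\<in>topspace T. \<exists>i\<in>I. 0 < g i x)"
proof -
  let ?U = "\<lambda>i. {x \<in> topspace T. g i x \<in> {0<..}}"
  have "openin T (?U i)" if "i \<in> C" for i
    using g[OF that] by (rule openin_continuous_map_preimage) simp
  moreover have "topspace T \<subseteq> \<Union> (?U ` C)"
    using pos by auto
  ultimately obtain \<F> where \<F>: "finite \<F>" "\<F> \<subseteq> ?U ` C" "topspace T \<subseteq> \<Union>\<F>"
    using compact_T[unfolded compact_space_alt, rule_format, of "?U ` C"] by auto
  obtain I where "I \<subseteq> C" "finite I" "\<F> = ?U ` I"
    using finite_subset_image[OF \<F>(1,2)] by blast
  with \<F>(3) show ?thesis by (intro exI[of _ I]) auto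
qed

definition orbit_function :: "'x \<Rightarrow> ('x \<Rightarrow> real) \<Rightarrow> 's \<Rightarrow> complex" where
  "orbit_function x f = (\<lambda>s. complex_of_real (f (act s x)))"

lemma orbit_function_bcontfun:
  assumes x: "x \<in> topspace T" and f: "continuous_map T euclideanreal f"
  shows "orbit_function x f \<in> bcontfun"
proof -
  obtain B where B: "\<And>x. x \<in> topspace T \<Longrightarrow> \<bar>f x\<bar> \<le> B"
    using continuous_bounded[OF f] by blast
  have "continuous_map euclidean euclideanreal (f \<circ> (\<lambda>s. act s x))"
    using orbit_continuous[OF x] f by (rule continuous_map_compose)
  then have "continuous_on UNIV (\<lambda>s. f (act s x))"
    by (simp add: o_def)
  then show ?thesis
    unfolding orbit_function_def using B[OF act_in_topspace[OF x]]
    by (intro bcontfun_normI[of _ B]) (auto intro: continuous_intros)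
qed

lemma left_translate_orbit_function:
  "x \<in> topspace T \<Longrightarrow>
    left_translate s (orbit_function x f) = orbit_function x (\<lambda>y. f (act s y))"
  by (simp add: left_translate_def orbit_function_def act_act)

text \<open>
  The functions \<open>g f = \<bar>f - h f\<bar>\<^sup>2\<close> are annihilated by the character \<open>h\<close>. If they had no common
  zero, a finite sum of them would be invertible.
\<close>

lemma multiplicative_mean_point:
  assumes \<nu>: "multiplicative_mean \<nu>" and x: "x \<in> topspace T"
  shows "\<exists>y\<in>topspace T. \<forall>f. continuous_map T euclideanreal f \<longrightarrow>
    \<nu> (orbit_function x f) = complex_of_real (f y)"
proof (rule ccontr)
  assume neg: "\<not> ?thesis"
  define h where "h f = \<nu> (orbit_function x f)" for f
  let ?C = "\<lambda>f. continuous_map T euclideanreal f"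
  note bc = orbit_function_bcontfun[OF x]
  have \<nu>_add: "\<nu> (\<lambda>s. f s + g s) = \<nu> f + \<nu> g" and \<nu>_mult: "\<nu> (\<lambda>s. f s * g s) = \<nu> f * \<nu> g"
    and \<nu>_scale: "\<nu> (\<lambda>s. c * f s) = c * \<nu> f"
    if "f \<in> bcontfun" "g \<in> bcontfun" for f g c
    using \<nu> that unfolding multiplicative_mean_def mean_on_def dual_space_def by blast+
  have \<nu>_one: "\<nu> (\<lambda>_. 1) = 1"
    using \<nu> unfolding multiplicative_mean_def mean_on_def by blast
  have add: "h (\<lambda>x. f x + g x) = h f + h g" if "?C f" "?C g" for f g
    using \<nu>_add[OF bc bc, OF that] by (simp add: h_def orbit_function_def)
  have mult: "h (\<lambda>x. f x * g x) = h f * h g" if "?C f" "?C g" for f g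
    using \<nu>_mult[OF bc bc, OF that] by (simp add: h_def orbit_function_def)
  have scale: "h (\<lambda>x. c * f x) = complex_of_real c * h f" if "?C f" for f c
    using \<nu>_scale[OF bc bc, OF that that] by (simp add: h_def orbit_function_def)
  have one: "h (\<lambda>_. 1) = 1"
    using \<nu>_one by (simp add: h_def orbit_function_def)
  have const: "h (\<lambda>_. c) = complex_of_real c" for c
    using scale[of "\<lambda>_. 1" c] one by simp
  have hsum: "h (\<lambda>z. \<Sum>i\<in>I. k i z) = (\<Sum>i\<in>I. h (k i))"
    if "finite I" "\<And>i. i \<in> I \<Longrightarrow> ?C (k i)" for I :: "('x \<Rightarrow> real) set" and k
    using that
  proof (induction I rule: finite_induct)
    case empty
    then show ?case using const[of 0] by simp
  next
    case (insert i I)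
    then show ?case using add[of "k i" "\<lambda>z. \<Sum>i\<in>I. k i z"] by (simp add: continuous_map_sum)
  qed
  define g where "g f z = (f z - Re (h f))\<^sup>2 + (Im (h f))\<^sup>2" for f z
  have gC: "?C (g f)" if "?C f" for f
    unfolding g_def using that by (intro continuous_intros) auto
  have h_g: "h (g f) = 0" if f: "?C f" for f
  proof -
    let ?a = "Re (h f)" and ?b = "Im (h f)"
    \<comment> \<open>\<open>h f\<close> is a root of the real quadratic polynomial with roots
      \<open>h f\<close> and its conjugate; as \<open>h\<close> respects sums, products and
      constants, \<open>h (g f) = 0\<close>.\<close>
    have "g f = (\<lambda>z. (f z * f z + (- 2 * ?a) * f z) + (?a\<^sup>2 + ?b\<^sup>2))"
      unfolding g_def by (auto simp: power2_eq_square algebra_simps)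
    moreover have "h (\<lambda>z. (f z * f z + (- 2 * ?a) * f z) + (?a\<^sup>2 + ?b\<^sup>2))
        = h f * h f + complex_of_real (- 2 * ?a) * h f + complex_of_real (?a\<^sup>2 + ?b\<^sup>2)"
      using f by (subst add add, (auto intro!: continuous_intros)[2])+
        (simp only: mult scale const f of_real_add)
    moreover have "\<dots> = 0"
      by (simp add: complex_eq_iff power2_eq_square algebra_simps)
    ultimately show ?thesis by simp
  qed
  have "\<exists>f. ?C f \<and> 0 < g f y" if y: "y \<in> topspace T" for y
  proof -
    obtain f where f: "?C f" "h f \<noteq> complex_of_real (f y)"
      using neg y unfolding h_def by blast
    then have "f y - Re (h f) \<noteq> 0 \<or> Im (h f) \<noteq> 0"
      by (auto simp: complex_eq_iff)
    then have "0 < g f y"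
      unfolding g_def by (auto intro: add_pos_nonneg add_nonneg_pos)
    with f(1) show ?thesis by blast
  qed
  then have "\<exists>I. finite I \<and> I \<subseteq> {f. ?C f} \<and> (\<forall>y\<in>topspace T. \<exists>f\<in>I. 0 < g f y)"
    using gC by (intro finite_positive_family) auto
  then obtain I where I: "finite I" "I \<subseteq> {f. ?C f}" "\<forall>y\<in>topspace T. \<exists>f\<in>I. 0 < g f y"
    by (elim exE conjE)
  define G where "G z = (\<Sum>f\<in>I. g f z)" for z
  have GC: "?C G" unfolding G_def using I gC by (intro continuous_map_sum) auto
  have "0 < G z" if "z \<in> topspace T" for z
  proof -
    obtain f where "f \<in> I" "0 < g f z" using I(3) \<open>z \<in> topspace T\<close> by auto
    then show ?thesis
      unfolding G_def using I(1) by (intro sum_pos2[of _ f]) (auto simp: g_def)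
  qed
  then have Gpos: "G z \<noteq> 0" if "z \<in> topspace T" for z
    using that by force
  have "h (\<lambda>z. G z * inverse (G z)) = h G * h (\<lambda>z. inverse (G z))"
    using GC Gpos by (intro mult continuous_map_real_inverse)
  moreover have "h G = 0"
    unfolding G_def using I h_g gC by (subst hsum) (auto intro!: sum.neutral)
  \<comment> \<open>Only values on the orbit of \<open>x\<close> enter, and \<open>G\<close> does
    not vanish there; \<open>h G = 0\<close> thus forces 1 = 0.\<close>
  moreover have "h (\<lambda>z. G z * inverse (G z)) = h (\<lambda>_. 1)"
    unfolding h_def orbit_function_def using Gpos act_in_topspace[OF x] by simp
  ultimately show False using one by simp
qed

text \<open>If the multiplicative mean \<open>\<nu>\<close> is evaluation at \<open>y\<close>, then
  applying \<open>\<nu>\<close> to the left translates gives \<open>orbit_function y f\<close>,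
  which is continuous because the orbit map of \<open>y\<close> is.\<close>

lemma orbit_function_LMC:
  assumes x: "x \<in> topspace T" and f: "continuous_map T euclideanreal f"
  shows "orbit_function x f \<in> LMC"
  unfolding LMC_def
proof (intro CollectI conjI)
  show "orbit_function x f \<in> bcontfun" using x f by (rule orbit_function_bcontfun)
  have bc: "left_translate s (orbit_function x f) \<in> bcontfun" for s
    unfolding left_translate_orbit_function[OF x]
    by (intro orbit_function_bcontfun x continuous_map_act f)
  show "continuous_map euclidean multiplicative_mean_topology
      (\<lambda>s. left_translate s (orbit_function x f))"
    unfolding multiplicative_mean_topology_def
  proof (rule continuous_on_generated_topo)
    fix V assume "V \<in> {{f \<in> bcontfun. \<mu> f \<in> U} |\<mu> U.
      multiplicative_mean (\<mu> :: ('s \<Rightarrow> complex) \<Rightarrow> complex) \<and> open U}"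
    then obtain \<nu> U where V: "V = {f \<in> bcontfun. \<nu> f \<in> U}"
        and \<nu>: "multiplicative_mean (\<nu> :: ('s \<Rightarrow> complex) \<Rightarrow> complex)" and U: "open U"
      by blast
    obtain y where y: "y \<in> topspace T"
        "\<And>f. continuous_map T euclideanreal f \<Longrightarrow> \<nu> (orbit_function x f) = complex_of_real (f y)"
      using multiplicative_mean_point[OF \<nu> x] by blast
    have "(\<lambda>s. left_translate s (orbit_function x f)) -` V = orbit_function y f -` U"
      using bc y(2)[OF continuous_map_act[OF f]]
      by (auto simp: V left_translate_orbit_function[OF x] orbit_function_def[of y])
    moreover have "open (orbit_function y f -` U)"
      using orbit_function_bcontfun[OF y(1) f] U
      by (simp add: bcontfun_def continuous_on_open_vimage)
    ultimately show "openin euclidean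
        ((\<lambda>s. left_translate s (orbit_function x f)) -` V \<inter> topspace euclidean)"
      by simp
  next
    \<comment> \<open>Continuity into a generated topology also requires the values to lie in the
      union of the generators; an evaluation with \<open>U = UNIV\<close> provides this.\<close>
    have "left_translate s (orbit_function x f) \<in> {f \<in> bcontfun. f undefined \<in> UNIV}" for s
      using bc by simp
    then show "(\<lambda>s. left_translate s (orbit_function x f)) ` topspace euclidean \<subseteq>
        \<Union> {{f \<in> bcontfun. \<mu> f \<in> U} |\<mu> U. multiplicative_mean \<mu> \<and> open U}"
      using multiplicative_mean_evaluation open_UNIV by blast
  qed
qed

end

section \<open>Invariant means on the continuous functions of a compact system\<close>

locale invariant_mean = compact_system T act
  for T :: "'x topology" and act :: "'s::semitopological_semigroup \<Rightarrow> 'x \<Rightarrow> 'x" +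
  fixes m :: "('x \<Rightarrow> real) \<Rightarrow> real"
  assumes Hausdorff_T: "Hausdorff_space T"
    and m_add: "continuous_map T euclideanreal f \<Longrightarrow> continuous_map T euclideanreal g \<Longrightarrow>
      m (\<lambda>x. f x + g x) = m f + m g"
    and m_scale: "continuous_map T euclideanreal f \<Longrightarrow> m (\<lambda>x. c * f x) = c * m f"
    and m_one: "m (\<lambda>_. 1) = 1"
    and m_nonneg: "continuous_map T euclideanreal f \<Longrightarrow>
      (\<And>x. x \<in> topspace T \<Longrightarrow> 0 \<le> f x) \<Longrightarrow> 0 \<le> m f"
    and m_act: "continuous_map T euclideanreal f \<Longrightarrow> m (\<lambda>x. f (act s x)) = m f"

text \<open>Left translation of an orbit function is composition of \<open>f\<close> with the
  action, so left invariance becomes invariance under \<open>act\<close>. Positivity comes from norm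
  one: for \<open>0 \<le> f \<le> B\<close> the function \<open>1 - f / B\<close> is bounded by 1,
  so the real part of its mean is at most 1.\<close>

lemma (in compact_system) invariant_mean_of_LMC:
  assumes \<mu>: "left_invariant_mean_on (LMC :: ('s \<Rightarrow> complex) set) \<mu>"
    and x: "x \<in> topspace T" and Hausdorff: "Hausdorff_space T"
  shows "invariant_mean T act (\<lambda>f. Re (\<mu> (orbit_function x f)))"
proof
  let ?C = "\<lambda>f. continuous_map T euclideanreal f"
  let ?m = "\<lambda>f. Re (\<mu> (orbit_function x f))"
  note lmc = orbit_function_LMC[OF x]
  have mean: "mean_on (LMC :: ('s \<Rightarrow> complex) set) \<mu>"
    using \<mu> by (simp add: left_invariant_mean_on_def)
  then have \<mu>_add: "\<mu> (\<lambda>s. f s + g s) = \<mu> f + \<mu> g" and \<mu>_scale: "\<mu> (\<lambda>s. c * f s) = c * \<mu> f"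
    if "f \<in> LMC" "g \<in> LMC" for f g c
    using that unfolding mean_on_def dual_space_def by blast+
  have add: "\<mu> (orbit_function x (\<lambda>x. f x + g x)) = \<mu> (orbit_function x f) + \<mu> (orbit_function x g)"
    if "?C f" "?C g" for f g
    using \<mu>_add[OF lmc lmc, OF that] by (simp add: orbit_function_def)
  have scale: "\<mu> (orbit_function x (\<lambda>x. c * f x)) = complex_of_real c * \<mu> (orbit_function x f)"
    if "?C f" for f c
    using \<mu>_scale[OF lmc lmc, OF that that] by (simp add: orbit_function_def)
  have one: "\<mu> (orbit_function x (\<lambda>_. 1)) = 1"
    using mean by (simp add: orbit_function_def mean_on_def)
  show "?m (\<lambda>x. f x + g x) = ?m f + ?m g" if "?C f" "?C g" for f g
    using add[OF that] by simp
  show "?m (\<lambda>x. c * f x) = c * ?m f" if "?C f" for f c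
    using scale[OF that] by simp
  show "?m (\<lambda>_. 1) = 1" using one by simp
  show "?m (\<lambda>x. f (act s x)) = ?m f" if "?C f" for f s
    using \<mu> lmc[OF that] unfolding left_invariant_mean_on_def
    by (simp add: left_translate_orbit_function[OF x, symmetric])
  show "0 \<le> ?m f" if f: "?C f" and nonneg: "\<And>x. x \<in> topspace T \<Longrightarrow> 0 \<le> f x" for f
  proof -
    obtain B where B: "0 < B" "\<And>x. x \<in> topspace T \<Longrightarrow> \<bar>f x\<bar> \<le> B"
      using continuous_bounded[OF f] by blast
    let ?g = "\<lambda>x. 1 + (- 1 / B) * f x"
    have g: "?C ?g" using f by (intro continuous_intros) auto
    have LMC_sub: "(LMC :: ('s \<Rightarrow> complex) set) \<subseteq> bcontfun"
      by (auto simp: LMC_def)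
    have "norm (orbit_function x ?g s) \<le> 1" for s
    proof -
      have "0 \<le> f (act s x)" "f (act s x) \<le> B"
        using nonneg[OF act_in_topspace[OF x]] B(2)[OF act_in_topspace[OF x]] by force+
      then have "\<bar>1 + (- 1 / B) * f (act s x)\<bar> \<le> 1"
        using B(1) by (simp add: field_simps abs_le_iff)
      then show ?thesis
        unfolding orbit_function_def norm_of_real .
    qed
    then have "norm (\<mu> (orbit_function x ?g)) \<le> 1"
      by (intro mean_on_contractive[OF mean LMC_sub lmc[OF g]])
    moreover have "\<mu> (orbit_function x ?g) = 1 + complex_of_real (- 1 / B) * \<mu> (orbit_function x f)"
    proof -
      have "?C (\<lambda>_. 1)" by simp
      from add[OF this continuous_map_real_mult_left[OF f]] show ?thesis
        unfolding scale[OF f] one .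
    qed
    ultimately have "Re (1 + complex_of_real (- 1 / B) * \<mu> (orbit_function x f)) \<le> 1"
      using complex_Re_le_cmod order_trans by metis
    then show ?thesis using B(1) by (simp add: field_simps zero_le_divide_iff)
  qed
qed (rule Hausdorff)

section \<open>Minimal systems\<close>

locale minimal_invariant_mean = invariant_mean T act m
  for T :: "'x topology" and act :: "'s::semitopological_semigroup \<Rightarrow> 'x \<Rightarrow> 'x" and m +
  assumes nonempty: "topspace T \<noteq> {}"
    and minimal: "closedin T A \<Longrightarrow> A \<noteq> {} \<Longrightarrow> (\<And>s x. x \<in> A \<Longrightarrow> act s x \<in> A) \<Longrightarrow> A = topspace T"
begin

lemma m_const: "m (\<lambda>_. c) = c"
  using m_scale[of "\<lambda>_. 1" c] m_one by simp

lemma m_mono: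
  assumes "continuous_map T euclideanreal f" "continuous_map T euclideanreal g"
    and "\<And>x. x \<in> topspace T \<Longrightarrow> f x \<le> g x"
  shows "m f \<le> m g"
proof -
  have d: "continuous_map T euclideanreal (\<lambda>x. g x - f x)"
    using assms by (intro continuous_map_diff)
  then have "0 \<le> m (\<lambda>x. g x - f x)"
    using assms(3) by (intro m_nonneg) auto
  moreover have "m g = m f + m (\<lambda>x. g x - f x)"
    using m_add[OF assms(1) d] by simp
  ultimately show ?thesis by simp
qed

lemma m_sum:
  assumes "finite I" "\<And>i. i \<in> I \<Longrightarrow> continuous_map T euclideanreal (k i)"
  shows "m (\<lambda>x. \<Sum>i\<in>I. k i x) = (\<Sum>i\<in>I. m (k i))"
  using assms
proof (induction I rule: finite_induct)
  case empty
  then show ?case using m_const[of 0] by simp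
next
  case (insert i I)
  then show ?case
    using m_add[of "k i" "\<lambda>x. \<Sum>i\<in>I. k i x"] by (simp add: continuous_map_sum)
qed

lemma Urysohn:
  assumes "closedin T A" "closedin T B" "disjnt A B"
  shows "\<exists>u. continuous_map T euclideanreal u \<and> (\<forall>x\<in>topspace T. 0 \<le> u x \<and> u x \<le> 1) \<and>
    (\<forall>x\<in>A. u x = 0) \<and> (\<forall>x\<in>B. u x = 1)"
proof -
  have "normal_space T"
    using compact_Hausdorff_or_regular_imp_normal_space[OF compact_T] Hausdorff_T by blast
  then obtain u where u: "continuous_map T (top_of_set {0..1::real}) u" "u ` A \<subseteq> {0}" "u ` B \<subseteq> {1}"
    using Urysohn_lemma[of T A B 0 1] assms by auto
  then have "continuous_map T euclideanreal u" "u ` topspace T \<subseteq> {0..1}"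
    by (auto simp: continuous_map_in_subtopology)
  with u(2,3) show ?thesis by (intro exI[of _ u]) auto
qed

lemma Urysohn_point:
  assumes "closedin T A" "z \<in> topspace T" "z \<notin> A"
  shows "\<exists>u. continuous_map T euclideanreal u \<and> (\<forall>x\<in>topspace T. 0 \<le> u x \<and> u x \<le> 1) \<and>
    (\<forall>x\<in>A. u x = 0) \<and> u z = 1"
proof -
  have "closedin T {z}"
    by (rule closedin_Hausdorff_singleton[OF Hausdorff_T assms(2)])
  moreover have "disjnt A {z}" using assms(3) by (auto simp: disjnt_iff)
  ultimately show ?thesis
    using Urysohn[OF assms(1), of "{z}"] by simp
qed

text \<open>The support of the mean is closed and invariant, so it is the whole space.\<close>

lemma m_pos:
  assumes f: "continuous_map T euclideanreal f" "\<And>x. x \<in> topspace T \<Longrightarrow> 0 \<le> f x"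
    and x: "x \<in> topspace T" "0 < f x"
  shows "0 < m f"
proof -
  define P where "P f \<longleftrightarrow> continuous_map T euclideanreal f \<and> (\<forall>x\<in>topspace T. 0 \<le> f x)" for f
  \<comment> \<open>The complement is the union of the open sets where some nonnegative continuous
    function with mean at most 0 is positive.\<close>
  define supp where "supp = {x \<in> topspace T. \<forall>f. P f \<and> 0 < f x \<longrightarrow> 0 < m f}"
  have opn: "openin T {x \<in> topspace T. f x \<in> {0<..}}" if "P f" for f
    using that unfolding P_def by (intro openin_continuous_map_preimage[of T euclideanreal]) auto
  have "topspace T - supp = \<Union> ((\<lambda>f. {x \<in> topspace T. f x \<in> {0<..}}) ` {f. P f \<and> \<not> 0 < m f})"
    unfolding supp_def by auto
  then have "openin T (topspace T - supp)"
    using opn by auto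
  then have "closedin T supp"
    unfolding closedin_def supp_def by auto
  moreover have "supp \<noteq> {}"
  proof
    assume "supp = {}"
    then have "\<exists>f\<in>{f. P f \<and> \<not> 0 < m f}. 0 < f x" if "x \<in> topspace T" for x
      using that unfolding supp_def by blast
    then have "\<exists>I. finite I \<and> I \<subseteq> {f. P f \<and> \<not> 0 < m f} \<and> (\<forall>x\<in>topspace T. \<exists>f\<in>I. 0 < f x)"
      by (intro finite_positive_family) (auto simp: P_def)
    then obtain I where I: "finite I" "I \<subseteq> {f. P f \<and> \<not> 0 < m f}"
        "\<forall>x\<in>topspace T. \<exists>f\<in>I. 0 < f x"
      by (elim exE conjE)
    define G where "G z = (\<Sum>f\<in>I. f z)" for z
    have GC: "continuous_map T euclideanreal G"
      unfolding G_def using I(1,2) by (intro continuous_map_sum) (auto simp: P_def)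
    have Gpos: "0 < G z" if z: "z \<in> topspace T" for z
    proof -
      obtain f where "f \<in> I" "0 < f z" using I(3) z by auto
      then show ?thesis
        unfolding G_def using I(1,2) z by (intro sum_pos2[of _ f]) (auto simp: P_def)
    qed
    have "continuous_map T euclideanreal (\<lambda>z. inverse (G z))"
      using GC Gpos by (intro continuous_map_real_inverse) force+
    then obtain B where B: "0 < B" "\<And>z. z \<in> topspace T \<Longrightarrow> \<bar>inverse (G z)\<bar> \<le> B"
      using continuous_bounded by blast
    \<comment> \<open>The sum \<open>G\<close> of functions with mean at most 0 would lie above a
      positive constant, whose mean is that constant.\<close>
    have "inverse B \<le> G z" if "z \<in> topspace T" for z
      using B(2)[OF that] B(1) Gpos[OF that] by (simp add: field_simps)
    then have "m (\<lambda>_. inverse B) \<le> m G"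
      using GC by (intro m_mono) auto
    moreover have "m G \<le> 0"
      unfolding G_def using I(1,2) by (subst m_sum) (auto simp: P_def not_less intro!: sum_nonpos)
    moreover have "0 < inverse B" using B(1) by simp
    ultimately show False unfolding m_const by linarith
  qed
  moreover have "act s x \<in> supp" if x: "x \<in> supp" for s x
  proof -
    have xT: "x \<in> topspace T" using x by (simp add: supp_def)
    have "0 < m f" if f: "P f" "0 < f (act s x)" for f
    proof -
      have "P (\<lambda>x. f (act s x))"
        using f(1) continuous_map_act act_in_topspace unfolding P_def by auto
      then have "0 < m (\<lambda>x. f (act s x))"
        using x f(2) unfolding supp_def by blast
      then show ?thesis using m_act f(1) by (simp add: P_def)
    qed
    then show ?thesis using act_in_topspace[OF xT] unfolding supp_def by blast
  qed
  ultimately have "supp = topspace T" by (rule minimal)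
  then show ?thesis using f x unfolding supp_def P_def by blast
qed

text \<open>A Urysohn function that is 0 on the closed image and 1 at a missed point
  \<open>z\<close> has mean at most 0 by invariance, against \<open>m_pos\<close>.\<close>

lemma act_surj: "act s ` topspace T = topspace T"
proof (rule ccontr)
  assume neq: "\<not> ?thesis"
  obtain z where z: "z \<in> topspace T" "z \<notin> act s ` topspace T"
    using neq act_in_topspace by blast
  have "compactin T (act s ` topspace T)"
    using compact_T act_continuous image_compactin unfolding compact_space_def by metis
  then have "closedin T (act s ` topspace T)"
    using Hausdorff_T compactin_imp_closedin by blast
  from Urysohn_point[OF this z] obtain u where u: "continuous_map T euclideanreal u"
      "\<forall>x\<in>topspace T. 0 \<le> u x \<and> u x \<le> 1" "\<forall>x\<in>act s ` topspace T. u x = 0" "u z = 1"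
    by (elim exE conjE)
  have "m u = m (\<lambda>x. u (act s x))" using m_act u(1) by simp
  also have "\<dots> \<le> m (\<lambda>_. 0)"
    using u(3) by (intro m_mono[OF continuous_map_act[OF u(1)]]) auto
  finally have "m u \<le> 0" by (simp add: m_const)
  moreover have "0 < m u"
    using u(2,4) z(1) by (intro m_pos[OF u(1)]) auto
  ultimately show False by simp
qed

text \<open>All the sets \<open>act s ` A\<close> have at least the mass of \<open>A\<close>, so few of them can be disjoint.\<close>

lemma card_disjoint_translates:
  assumes f: "continuous_map T euclideanreal f" "\<And>x. x \<in> topspace T \<Longrightarrow> f x \<le> 1"
      "\<And>x. x \<in> topspace T - A \<Longrightarrow> f x = 0"
    and A: "closedin T A" and "finite I" "pairwise (\<lambda>s t. disjnt (act s ` A) (act t ` A)) I"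
    and g: "continuous_map T euclideanreal g" "\<And>x. x \<in> topspace T \<Longrightarrow> 0 \<le> g x"
      "\<And>s x. s \<in> I \<Longrightarrow> x \<in> A \<Longrightarrow> 1 \<le> g (act s x)"
  shows "card I * m f \<le> m g"
  using assms(5-)
proof (induction I arbitrary: g rule: finite_induct)
  case empty
  then show ?case using m_nonneg by simp
next
  case (insert s I g)
  have clos: "closedin T (act t ` A)" for t
  proof -
    have "compactin T A" using A compact_T by (rule closedin_compact_space[rotated])
    then show ?thesis
      using act_continuous Hausdorff_T by (intro compactin_imp_closedin image_compactin)
  qed
  have "closedin T (\<Union>t\<in>I. act t ` A)"
    using insert.hyps(1) clos by (intro closedin_Union) auto
  moreover have "disjnt (\<Union>t\<in>I. act t ` A) (act s ` A)"
    using insert.prems(1) insert.hyps(2) by (auto simp: pairwise_insert disjnt_iff)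
  \<comment> \<open>\<open>u\<close> splits \<open>g\<close> into \<open>g * u\<close>, which is at
    least 1 on the translate by \<open>s\<close>, and \<open>g * (1 - u)\<close>, which is at least
    1 on the others and enters the induction hypothesis.\<close>
  ultimately have "\<exists>u. continuous_map T euclideanreal u \<and> (\<forall>x\<in>topspace T. 0 \<le> u x \<and> u x \<le> 1) \<and>
      (\<forall>x\<in>(\<Union>t\<in>I. act t ` A). u x = 0) \<and> (\<forall>x\<in>act s ` A. u x = 1)"
    by (rule Urysohn[OF _ clos])
  then obtain u where u: "continuous_map T euclideanreal u"
      "\<forall>x\<in>topspace T. 0 \<le> u x \<and> u x \<le> 1"
      "\<forall>x\<in>(\<Union>t\<in>I. act t ` A). u x = 0" "\<forall>x\<in>act s ` A. u x = 1"
    by (elim exE conjE)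
  have c1: "continuous_map T euclideanreal (\<lambda>x. g x * u x)"
    and c2: "continuous_map T euclideanreal (\<lambda>x. g x * (1 - u x))"
    using insert.prems(2) u(1) by (auto intro!: continuous_intros)
  have "card I * m f \<le> m (\<lambda>x. g x * (1 - u x))"
  proof (rule insert.IH)
    show "pairwise (\<lambda>s t. disjnt (act s ` A) (act t ` A)) I"
      using insert.prems(1) by (auto simp: pairwise_insert)
    show "0 \<le> g x * (1 - u x)" if "x \<in> topspace T" for x
      using insert.prems(3)[OF that] bspec[OF u(2) that] by simp
    show "1 \<le> g (act t x) * (1 - u (act t x))" if "t \<in> I" "x \<in> A" for t x
      using insert.prems(4)[of t x] that u(3) by force
  qed (rule c2)
  moreover have "m f \<le> m (\<lambda>x. g x * u x)"
  proof -
    \<comment> \<open>\<open>f\<close> lies below the pullback of \<open>g * u\<close> under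
      \<open>act s\<close>, and invariance removes the pullback.\<close>
    have "m f \<le> m (\<lambda>x. g (act s x) * u (act s x))"
    proof (rule m_mono[OF f(1) continuous_map_act[OF c1]])
      fix x assume x: "x \<in> topspace T"
      show "f x \<le> g (act s x) * u (act s x)"
      proof (cases "x \<in> A")
        case True
        then show ?thesis
          using f(2)[OF x] insert.prems(4)[of s x] True u(4) by force
      next
        case False
        then show ?thesis
          using f(3) x insert.prems(3) u(2) act_in_topspace[OF x] by simp
      qed
    qed
    then show ?thesis using m_act[OF c1] by simp
  qed
  moreover have "m g = m (\<lambda>x. g x * (1 - u x)) + m (\<lambda>x. g x * u x)"
    using m_add[OF c2 c1] by (simp add: algebra_simps)
  ultimately show ?case
    using insert.hyps by (simp add: algebra_simps)
qed

text \<open>Take a disjoint family of translates of maximal size, which exists because the mass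
  bounds its size by \<open>1 / m f\<close>. Every translate then meets a member of the
  family.\<close>

lemma finitely_many_translates:
  assumes U: "openin T U" "U \<noteq> {}" and A: "closedin T A" "U \<subseteq> A"
  obtains I where "finite I" "\<And>s. \<exists>i\<in>I. act s ` A \<inter> act i ` A \<noteq> {}"
proof -
  obtain x where x: "x \<in> U" using U(2) by blast
  have xT: "x \<in> topspace T" using x U(1) openin_subset by blast
  have "x \<notin> topspace T - U" using x by blast
  from Urysohn_point[OF closedin_diff[OF closedin_topspace U(1)] xT this]
  obtain f where f: "continuous_map T euclideanreal f"
      "\<forall>x\<in>topspace T. 0 \<le> f x \<and> f x \<le> 1" "\<forall>y\<in>topspace T - U. f y = 0" "f x = 1"
    by (elim exE conjE)
  have mf: "0 < m f" using f(2,4) xT by (intro m_pos[OF f(1), of x]) auto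
  define P where "P I \<longleftrightarrow> finite I \<and> pairwise (\<lambda>s t. disjnt (act s ` A) (act t ` A)) I" for I
  have bound: "card I < nat \<lceil>1 / m f\<rceil> + 1" if "P I" for I
  proof -
    have "card I * m f \<le> m (\<lambda>_. 1)"
      using that f A(2) unfolding P_def
      by (intro card_disjoint_translates[OF f(1) _ _ A(1)]) auto
    then have "card I \<le> 1 / m f" using mf by (simp add: m_one field_simps)
    then show ?thesis by linarith
  qed
  have "P {}" by (simp add: P_def)
  then obtain I where I: "P I" "\<And>J. P J \<Longrightarrow> card J \<le> card I"
    using ex_has_greatest_nat[of P "{}" card] bound by (metis less_imp_le)
  have "\<exists>i\<in>I. act s ` A \<inter> act i ` A \<noteq> {}" for s
  proof (rule ccontr)
    assume none: "\<not> ?thesis"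
    \<comment> \<open>As \<open>A\<close> is nonempty, a translate by a member of \<open>I\<close>
      would meet itself.\<close>
    have "s \<notin> I" using none x A(2) by blast
    moreover have "P (insert s I)"
      using I(1) none unfolding P_def by (auto simp: pairwise_insert disjnt_def Int_commute)
    ultimately show False
      using I(2)[of "insert s I"] I(1) by (simp add: P_def)
  qed
  with I(1) show thesis by (intro that[of I]) (auto simp: P_def)
qed

end

section \<open>Nonexpansive minimal systems: total boundedness and nondiametral points\<close>

locale minimal_nonexpansive_system =
  minimal_invariant_mean T act m + weakly_compact_seminorm p T
  for p :: "'x::real_vector \<Rightarrow> real" and T :: "'x topology"
    and act :: "'s::semitopological_semigroup \<Rightarrow> 'x \<Rightarrow> 'x" and m +
  assumes nonexpansive: "x \<in> topspace T \<Longrightarrow> y \<in> topspace T \<Longrightarrow> p (act s x - act s y) \<le> p (x - y)"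
begin

text \<open>A \<open>p\<close>-small closed set \<open>A\<close> with nonempty interior has
  \<open>p\<close>-small translates, each meeting one of finitely many of them. So the orbit of
  \<open>x\<close> stays near finitely many points, and minimality together with surjectivity
  extends this to the whole space.\<close>

lemma finite_net:
  assumes "0 < e"
  obtains Z where "finite Z" "Z \<subseteq> topspace T" "\<And>y. y \<in> topspace T \<Longrightarrow> \<exists>z\<in>Z. p (y - z) \<le> e"
proof -
  obtain W where W: "openin T W" "W \<noteq> {}" "\<And>x y. x \<in> W \<Longrightarrow> y \<in> W \<Longrightarrow> p (x - y) \<le> e / 2"
    using small_open_set[of "e / 2"] assms nonempty by auto
  then obtain x where "x \<in> W" by blast
  moreover have "regular_space T"
    using compact_Hausdorff_imp_regular_space[OF compact_T Hausdorff_T] .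
  ultimately obtain U A where UA: "openin T U" "closedin T A" "x \<in> U" "U \<subseteq> A" "A \<subseteq> W"
    unfolding neighbourhood_base_of_closedin[symmetric] neighbourhood_base_of
    using W(1) by meson
  have AT: "A \<subseteq> topspace T" using UA(2) by (rule closedin_subset)
  have x: "x \<in> A" "x \<in> topspace T" using UA AT by auto
  obtain I where I: "finite I" "\<And>s. \<exists>i\<in>I. act s ` A \<inter> act i ` A \<noteq> {}"
    using finitely_many_translates[OF UA(1) _ UA(2,4)] UA(3) by blast
  define Z where "Z = (\<lambda>i. act i x) ` I"
  let ?N = "\<Union>z\<in>Z. {y \<in> topspace T. p (y - z) \<le> e}"
  have near: "act s x \<in> ?N" for s
  proof -
    obtain i a b where iab: "i \<in> I" "a \<in> A" "b \<in> A" "act s a = act i b"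
      using I(2)[of s] by blast
    have "p (act s x - act s a) \<le> e / 2" "p (act i b - act i x) \<le> e / 2"
      using nonexpansive[of x a s] nonexpansive[of b x i] W(3) iab(2,3) x UA(5) AT
      by (meson order_trans subsetD)+
    then have "p (act s x - act i x) \<le> e"
      using triangle_diff[of "act s x" "act i x" "act s a"] iab(4) by simp
    then show ?thesis
      using iab(1) act_in_topspace[OF x(2)] unfolding Z_def by blast
  qed
  have fin: "finite Z" unfolding Z_def using I(1) by simp
  have N: "closedin T ?N"
    using fin closedin_cball by (intro closedin_Union) auto
  define F where "F = {y \<in> topspace T. \<forall>s. act s y \<in> ?N}"
  have "F = topspace T"
  proof (rule minimal)
    have "closedin T (topspace T \<inter> (\<Inter>s. {y \<in> topspace T. act s y \<in> ?N}))"
      using N closedin_continuous_map_preimage[OF act_continuous]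
      by (intro closedin_Int closedin_topspace closedin_Inter) blast+
    moreover have "F = topspace T \<inter> (\<Inter>s. {y \<in> topspace T. act s y \<in> ?N})"
      unfolding F_def by blast
    ultimately show "closedin T F" by (simp only:)
    show "F \<noteq> {}" using near x(2) unfolding F_def by blast
    show "act s y \<in> F" if "y \<in> F" for s y
      using that act_in_topspace act_act unfolding F_def by (simp only: mem_Collect_eq simp_thms)
  qed
  show thesis
  proof
    show "Z \<subseteq> topspace T" unfolding Z_def using act_in_topspace[OF x(2)] by blast
    fix y assume "y \<in> topspace T"
    \<comment> \<open>Membership in \<open>F\<close> speaks only of translates, and the semigroup
      may lack an identity; so \<open>y\<close> is written as a translate by an arbitrary element,
      here \<open>undefined\<close>.\<close>
    then obtain y' where "y' \<in> F" "y = act undefined y'"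
      using act_surj[of undefined] \<open>F = topspace T\<close> by blast
    then have "y \<in> ?N" unfolding F_def by blast
    then show "\<exists>z\<in>Z. p (y - z) \<le> e" by blast
  qed (rule fin)
qed

text \<open>DeMarr's lemma: the barycentre of a fine net is not diametral.\<close>

lemma nondiametral_point:
  assumes "x \<in> topspace T" "y \<in> topspace T" "0 < p (x - y)"
  obtains u r where "u \<in> convex hull (topspace T)" "\<And>y. y \<in> topspace T \<Longrightarrow> p (u - y) \<le> r"
    "\<exists>x\<in>topspace T. \<exists>y\<in>topspace T. r < p (x - y)"
proof -
  define D where "D = (\<lambda>(x, y). p (x - y)) ` (topspace T \<times> topspace T)"
  \<comment> \<open>A net of radius 1 bounds all distances, so that the diameter \<open>d\<close> is
    a genuine supremum.\<close>
  obtain Z1 where Z1: "finite Z1" "Z1 \<subseteq> topspace T"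
      "\<And>y. y \<in> topspace T \<Longrightarrow> \<exists>z\<in>Z1. p (y - z) \<le> 1"
    using finite_net[of 1] by auto
  define B where "B = Max ((\<lambda>(z, w). p (z - w)) ` (Z1 \<times> Z1))"
  have "p (a - b) \<le> 2 + B" if ab: "a \<in> topspace T" "b \<in> topspace T" for a b
  proof -
    obtain z w where zw: "z \<in> Z1" "w \<in> Z1" "p (a - z) \<le> 1" "p (b - w) \<le> 1"
      using Z1(3) ab by blast
    then have "p (z - w) \<le> B"
      unfolding B_def using Z1(1) by (intro Max_ge) force+
    then show ?thesis
      using zw(3,4) triangle_diff[of a b z] triangle_diff[of z b w] commute[of w b] by simp
  qed
  then have bdd: "bdd_above D" unfolding D_def by (auto intro!: bdd_aboveI)
  define d where "d = Sup D"
  have le: "p (a - b) \<le> d" if "a \<in> topspace T" "b \<in> topspace T" for a b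
    unfolding d_def using that bdd by (intro cSup_upper) (auto simp: D_def)
  have d: "0 < d" using le[OF assms(1,2)] assms(3) by simp
  obtain Z where Z: "finite Z" "Z \<subseteq> topspace T" "\<And>y. y \<in> topspace T \<Longrightarrow> \<exists>z\<in>Z. p (y - z) \<le> d / 2"
    using finite_net[of "d / 2"] d by auto
  have Zne: "Z \<noteq> {}" using Z(3)[OF assms(1)] by blast
  define n where "n = real (card Z)"
  have n: "0 < n" unfolding n_def using Zne Z(1) by (simp add: card_gt_0_iff)
  define u where "u = (\<Sum>z\<in>Z. (1 / n) *\<^sub>R z)"
  \<comment> \<open>Among the \<open>n\<close> distances from a point to the net, one is at most
    \<open>d / 2\<close> and the others at most \<open>d\<close>; \<open>r\<close> is the average of
    these bounds.\<close>
  define r where "r = d - d / (2 * n)"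
  have "p (u - y) \<le> r" if y: "y \<in> topspace T" for y
  proof -
    obtain z0 where z0: "z0 \<in> Z" "p (y - z0) \<le> d / 2" using Z(3)[OF y] by blast
    have "u - y = (\<Sum>z\<in>Z. (1 / n) *\<^sub>R (z - y))"
      unfolding u_def using n by (simp add: scaleR_diff_right sum_subtractf n_def flip: scaleR_left.sum)
    then have "p (u - y) \<le> (\<Sum>z\<in>Z. p ((1 / n) *\<^sub>R (z - y)))"
      by (simp only: sum_le)
    also have "\<dots> = (\<Sum>z\<in>Z. (1 / n) * p (z - y))"
      using n by (simp add: scaleR)
    also have "\<dots> \<le> (\<Sum>z\<in>Z. (1 / n) * (if z = z0 then d / 2 else d))"
    proof (intro sum_mono mult_left_mono)
      show "p (z - y) \<le> (if z = z0 then d / 2 else d)" if "z \<in> Z" for z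
        using z0 commute[of y z0] le[of z y] that Z(2) y by auto
    qed (use n in simp)
    also have "\<dots> = (1 / n) * (\<Sum>z\<in>Z. d - (if z = z0 then d / 2 else 0))"
      unfolding sum_distrib_left by (intro sum.cong) auto
    also have "\<dots> = (1 / n) * (n * d - d / 2)"
      using z0(1) Z(1) by (simp add: sum_subtractf n_def)
    also have "\<dots> = r"
      unfolding r_def using n by (simp add: field_simps)
    finally show ?thesis .
  qed
  moreover have "u \<in> convex hull (topspace T)"
    unfolding u_def using Z(1,2) n
    by (intro convex_sum convex_convex_hull) (auto simp: n_def hull_inc)
  moreover have "\<exists>x\<in>topspace T. \<exists>y\<in>topspace T. r < p (x - y)"
  proof -
    have "r < Sup D" unfolding r_def d_def[symmetric] using d n by simp
    moreover have "D \<noteq> {}" unfolding D_def using assms(1) by blast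
    ultimately show ?thesis
      using less_cSup_iff[OF _ bdd, of r] unfolding D_def by auto
  qed
  ultimately show thesis using that by blast
qed

end

section \<open>The fixed point property\<close>

lemma Inter_finite_chain:
  assumes "finite \<F>" "\<F> \<noteq> {}" "\<And>A B. A \<in> \<F> \<Longrightarrow> B \<in> \<F> \<Longrightarrow> A \<subseteq> B \<or> B \<subseteq> A"
  shows "\<Inter>\<F> \<in> \<F>"
  using assms
proof (induction \<F> rule: finite_ne_induct)
  case (insert A \<F>)
  then have "\<Inter>\<F> \<in> \<F>" by blast
  then have "A \<subseteq> \<Inter>\<F> \<or> \<Inter>\<F> \<subseteq> A" using insert.prems by blast
  then show ?case using \<open>\<Inter>\<F> \<in> \<F>\<close> by (auto simp: Int_absorb1 Int_absorb2)
qed simp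

text \<open>Zorn's lemma for reverse inclusion; compactness keeps the intersection of a chain
  nonempty. It is applied with \<open>P\<close> expressing convexity and invariance, and then
  invariance alone.\<close>

lemma minimal_closed_set:
  assumes T: "compact_space T" and A0: "closedin T A0" "A0 \<noteq> {}" "P A0"
    and P: "\<And>\<C>. \<C> \<noteq> {} \<Longrightarrow> (\<And>A. A \<in> \<C> \<Longrightarrow> P A) \<Longrightarrow> P (\<Inter>\<C>)"
  shows "\<exists>A. (closedin T A \<and> A \<noteq> {} \<and> P A \<and> A \<subseteq> A0) \<and>
    (\<forall>B. closedin T B \<and> B \<noteq> {} \<and> P B \<and> B \<subseteq> A \<longrightarrow> B = A)"
proof -
  define \<A> where "\<A> = {A. closedin T A \<and> A \<noteq> {} \<and> P A \<and> A \<subseteq> A0}"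
  have "\<exists>A\<in>\<A>. \<forall>B\<in>\<A>. A \<supseteq> B \<longrightarrow> B = A"
  proof (rule predicate_Zorn)
    show "partial_order_on \<A> (relation_of (\<supseteq>) \<A>)"
      by (rule partial_order_on_relation_ofI) auto
  next
    fix \<C> assume \<C>: "\<C> \<in> Chains (relation_of (\<supseteq>) \<A>)"
    show "\<exists>U\<in>\<A>. \<forall>A\<in>\<C>. A \<supseteq> U"
    proof (cases "\<C> = {}")
      case True
      then show ?thesis using A0 by (auto simp: \<A>_def)
    next
      case False
      have sub: "\<C> \<subseteq> \<A>" using \<C> by (rule Chains_relation_of)
      have chain: "A \<subseteq> B \<or> B \<subseteq> A" if "A \<in> \<C>" "B \<in> \<C>" for A B
        using \<C> that by (auto simp: Chains_def relation_of_def)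
      have "\<Inter>\<F> \<noteq> {}" if "finite \<F>" "\<F> \<subseteq> \<C>" for \<F>
      proof (cases "\<F> = {}")
        case False
        then have "\<Inter>\<F> \<in> \<F>" using that chain by (intro Inter_finite_chain) blast+
        then show ?thesis using that(2) sub unfolding \<A>_def by blast
      qed simp
      moreover have "closedin T A" if "A \<in> \<C>" for A
        using that sub by (auto simp: \<A>_def)
      ultimately have "(\<forall>A\<in>\<C>. closedin T A) \<and> (\<forall>\<F>. finite \<F> \<and> \<F> \<subseteq> \<C> \<longrightarrow> \<Inter>\<F> \<noteq> {})"
        by simp
      then have "\<Inter>\<C> \<noteq> {}"
        by (rule spec[OF iffD1[OF compact_space_fip T], THEN mp])
      moreover have "closedin T (\<Inter>\<C>)"
        using False sub by (intro closedin_Inter) (auto simp: \<A>_def)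
      moreover have "P (\<Inter>\<C>)" using False sub by (intro P) (auto simp: \<A>_def)
      moreover have "\<Inter>\<C> \<subseteq> A0" using False sub by (auto simp: \<A>_def)
      ultimately have "\<Inter>\<C> \<in> \<A>" by (simp add: \<A>_def)
      then show ?thesis by blast
    qed
  qed
  then obtain A where A: "A \<in> \<A>" "\<And>B. B \<in> \<A> \<Longrightarrow> B \<subseteq> A \<Longrightarrow> B = A" by blast
  have "B = A" if "closedin T B" "B \<noteq> {}" "P B" "B \<subseteq> A" for B
    using that A unfolding \<A>_def by blast
  with A(1) show ?thesis unfolding \<A>_def by blast
qed

lemma (in real_seminorm) convex_cball: "convex {x. p (x - y) \<le> r}"
proof (rule convexI)
  fix a b and s t :: real
  assume ab: "a \<in> {x. p (x - y) \<le> r}" "b \<in> {x. p (x - y) \<le> r}" and st: "0 \<le> s" "0 \<le> t" "s + t = 1"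
  have "s *\<^sub>R a + t *\<^sub>R b - y = s *\<^sub>R a + t *\<^sub>R b - (s + t) *\<^sub>R y"
    using st(3) by simp
  also have "\<dots> = s *\<^sub>R (a - y) + t *\<^sub>R (b - y)"
    by (simp add: algebra_simps)
  finally have "p (s *\<^sub>R a + t *\<^sub>R b - y) \<le> s * p (a - y) + t * p (b - y)"
    using triangle[of "s *\<^sub>R (a - y)" "t *\<^sub>R (b - y)"] st by (simp add: scaleR)
  also have "\<dots> \<le> s * r + t * r"
    using ab st by (intro add_mono mult_left_mono) auto
  also have "\<dots> = r" using st(3) by (simp flip: distrib_right)
  finally show "s *\<^sub>R a + t *\<^sub>R b \<in> {x. p (x - y) \<le> r}" by simp
qed

theorem theorem3p5:
  fixes scal :: "'k::{real_normed_field,euclidean_space} \<Rightarrow> 'x::real_vector \<Rightarrow> 'x"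
    and Q :: "('x \<Rightarrow> real) set"
    and K :: "'x set"
    and act :: "'s::semitopological_semigroup \<Rightarrow> 'x \<Rightarrow> 'x"
  assumes "\<exists>\<mu>. left_invariant_mean_on (LMC :: ('s \<Rightarrow> complex) set) \<mu>"
    and "locally_convex_space scal Q"
    and "K \<noteq> {}"
    and "convex K"
    and "compactin (weak_topology scal (seminorm_topology Q)) K"
    and "dynamical_system (subtopology (weak_topology scal (seminorm_topology Q)) K) act"
    and "nonexpansive_action Q K act"
  shows "\<exists>x\<in>K. \<forall>s. act s x = x"
proof -
  define W where "W = weak_topology scal (seminorm_topology Q)"
  note W = assms(5,6)[folded W_def]
  have Hausdorff: "Hausdorff_space W"
    unfolding W_def using assms(2) by (rule Hausdorff_weak_topology)
  have KW: "K \<subseteq> topspace W" and comp: "compact_space (subtopology W K)"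
    using W(1) by (auto simp: compactin_subspace)
  have topK: "topspace (subtopology W K) = K"
    using KW by auto
  interpret K: compact_system "subtopology W K" act
    by unfold_locales (use comp W(2) in auto)
  define invariant where "invariant A \<longleftrightarrow> (\<forall>s. \<forall>x\<in>A. act s x \<in> A)" for A
  have inv_Inter: "invariant (\<Inter>\<C>)" if "\<And>A. A \<in> \<C> \<Longrightarrow> invariant A" for \<C>
    using that unfolding invariant_def by blast
  have "invariant K" using K.act_in_topspace unfolding topK invariant_def by blast
  have "\<exists>A. (closedin (subtopology W K) A \<and> A \<noteq> {} \<and> (convex A \<and> invariant A) \<and> A \<subseteq> K) \<and>
      (\<forall>B. closedin (subtopology W K) B \<and> B \<noteq> {} \<and> (convex B \<and> invariant B) \<and> B \<subseteq> A \<longrightarrow> B = A)"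
  proof (rule minimal_closed_set[OF comp])
    show "closedin (subtopology W K) K"
      using closedin_topspace[of "subtopology W K"] unfolding topK .
    show "convex (\<Inter>\<C>) \<and> invariant (\<Inter>\<C>)" if "\<And>A. A \<in> \<C> \<Longrightarrow> convex A \<and> invariant A" for \<C>
      using that inv_Inter convex_Inter by blast
  qed (use assms(3,4) \<open>invariant K\<close> in auto)
  then obtain K0 where K0: "closedin (subtopology W K) K0" "K0 \<noteq> {}"
      "convex K0 \<and> invariant K0" "K0 \<subseteq> K"
    and K0_min: "\<forall>B. closedin (subtopology W K) B \<and> B \<noteq> {} \<and> (convex B \<and> invariant B) \<and>
        B \<subseteq> K0 \<longrightarrow> B = K0"
    by (elim exE conjE) blast
  \<comment> \<open>\<open>F\<close> is minimal among all closed invariant sets, convex or not,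
    because the support of a mean need not be convex.\<close>
  have "\<exists>A. (closedin (subtopology W K) A \<and> A \<noteq> {} \<and> invariant A \<and> A \<subseteq> K0) \<and>
      (\<forall>B. closedin (subtopology W K) B \<and> B \<noteq> {} \<and> invariant B \<and> B \<subseteq> A \<longrightarrow> B = A)"
    using K0(3) inv_Inter by (intro minimal_closed_set[OF comp K0(1,2)]) auto
  then obtain F where F: "closedin (subtopology W K) F" "F \<noteq> {}" "invariant F" "F \<subseteq> K0"
    and F_min: "\<forall>B. closedin (subtopology W K) B \<and> B \<noteq> {} \<and> invariant B \<and> B \<subseteq> F \<longrightarrow> B = F"
    by (elim exE conjE) blast
  have FK: "F \<subseteq> K" using F(4) K0(4) by blast
  have topF: "topspace (subtopology W F) = F" using FK KW by auto
  have sub: "subtopology (subtopology W K) F = subtopology W F"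
    using FK by (simp add: subtopology_subtopology Int_absorb1)
  have compF: "compact_space (subtopology W F)"
    using closedin_compact_space[OF comp F(1)] unfolding compactin_subspace sub by blast
  have HausdorffF: "Hausdorff_space (subtopology W F)"
    using Hausdorff by (rule Hausdorff_space_subtopology)
  interpret F: compact_system "subtopology W F" act
  proof
    show "dynamical_system (subtopology W F) act"
      unfolding dynamical_system_def topF
    proof (intro conjI allI ballI)
      show "act s (act t x) = act (s * t) x" if "x \<in> F" for s t x
        using K.act_act[of x] that FK unfolding topK by blast
      show "continuous_map euclidean (subtopology W F) (\<lambda>s. act s x)" if "x \<in> F" for x
        using K.orbit_continuous[of x] that FK F(3) unfolding topK sub[symmetric] invariant_def
        by (auto simp: continuous_map_in_subtopology)
      show "continuous_map (subtopology W F) (subtopology W F) (act s)" for s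
      proof -
        have "continuous_map (subtopology W F) (subtopology W K) (act s)"
          using continuous_map_from_subtopology[OF K.act_continuous[of s], of F] unfolding sub .
        moreover have "act s \<in> topspace (subtopology W F) \<rightarrow> F"
          using F(3) unfolding topF invariant_def by blast
        ultimately show ?thesis
          using continuous_map_into_subtopology[of _ "subtopology W K" "act s" F] unfolding sub by blast
      qed
    qed
  qed (rule compF)
  obtain \<mu> where \<mu>: "left_invariant_mean_on (LMC :: ('s \<Rightarrow> complex) set) \<mu>"
    using assms(1) by blast
  obtain x where x: "x \<in> F" using F(2) by blast
  have "invariant_mean (subtopology W F) act (\<lambda>f. Re (\<mu> (F.orbit_function x f)))"
    by (rule F.invariant_mean_of_LMC[OF \<mu> _ HausdorffF]) (simp only: topF x)
  then obtain m where "invariant_mean (subtopology W F) act m" by blast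
  then interpret m: invariant_mean "subtopology W F" act m .
  interpret m: minimal_invariant_mean "subtopology W F" act m
  proof
    show "topspace (subtopology W F) \<noteq> {}" using F(2) topF by simp
    fix A assume A: "closedin (subtopology W F) A" "A \<noteq> {}" "\<And>s x. x \<in> A \<Longrightarrow> act s x \<in> A"
    then have "closedin (subtopology W K) A"
      using closedin_trans_full[of "subtopology W K" F A] F(1) unfolding sub by blast
    moreover have "A \<subseteq> F" using closedin_subset[OF A(1)] topF by simp
    ultimately show "A = topspace (subtopology W F)"
      using F_min A(2,3) unfolding topF invariant_def by blast
  qed
  have seminorm: "real_seminorm p" if "p \<in> Q" for p
    using assms(2) that unfolding locally_convex_space_def by (blast intro: real_seminormI)
  \<comment> \<open>\<open>F\<close> is shown to be a single point, which its invariance then makes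
    fixed.\<close>
  have "y = x" if y: "y \<in> F" for y
  proof (rule ccontr)
    assume "y \<noteq> x"
    then obtain p where p: "p \<in> Q" "0 < p (y - x)"
      using seminorms_separate[OF seminorm, of Q y x] assms(2) unfolding locally_convex_space_def by blast
    interpret p: real_seminorm p using seminorm[OF p(1)] .
    have functional: "continuous_map (subtopology W A) euclideanreal f"
      if "linear f" "\<And>x. f x \<le> p x" for f A
      unfolding W_def using continuous_map_weak_topology[OF assms(2) p(1) that]
      by (rule continuous_map_from_subtopology)
    interpret K: weakly_compact_seminorm p "subtopology W K"
      by unfold_locales (use comp functional Hausdorff_space_subtopology[OF Hausdorff] in auto)
    interpret F: minimal_nonexpansive_system p "subtopology W F" act m
    proof
      fix a b s assume "a \<in> topspace (subtopology W F)" "b \<in> topspace (subtopology W F)"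
      then show "p (act s a - act s b) \<le> p (a - b)"
        using assms(7) p(1) FK unfolding nonexpansive_action_def topF by blast
    qed (use functional compF HausdorffF in auto)
    obtain u r where u: "u \<in> convex hull F" "\<And>y. y \<in> F \<Longrightarrow> p (u - y) \<le> r"
        and r: "\<exists>x\<in>F. \<exists>y\<in>F. r < p (x - y)"
      using F.nondiametral_point[of y x] p(2) x y unfolding topF by blast
    \<comment> \<open>The points of \<open>K0\<close> within \<open>r\<close> of all of
      \<open>F\<close>. The nondiametral point \<open>u\<close> is one of them, as the convex hull
      of \<open>F\<close> lies in \<open>K0\<close>.\<close>
    define C where "C = K0 \<inter> (\<Inter>y\<in>F. {x \<in> K. p (x - y) \<le> r})"
    have "C = K0"
    proof (rule K0_min[rule_format], intro conjI)
      show "closedin (subtopology W K) C"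
        unfolding C_def using F(2) K0(1) K.closedin_cball[unfolded topK]
        by (intro closedin_Int closedin_Inter) auto
      have "convex hull F \<subseteq> K0" using F(4) K0(3) by (simp add: hull_minimal)
      then show "C \<noteq> {}" unfolding C_def using u K0(4) by blast
      have "{x \<in> K. p (x - y) \<le> r} = K \<inter> {x. p (x - y) \<le> r}" for y by blast
      then show "convex C"
        unfolding C_def using K0(3) assms(4) p.convex_cball
        by (auto intro!: convex_Int convex_INT)
      show "invariant C"
        unfolding invariant_def
      proof (intro allI ballI)
        fix s v assume v: "v \<in> C"
        have "p (act s v - y) \<le> r" if "y \<in> F" for y
        proof -
          \<comment> \<open>Surjectivity on \<open>F\<close> writes every \<open>y\<close> as a
            translate by the same \<open>s\<close>, so that nonexpansiveness applies.\<close>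
          have "y \<in> act s ` F" using m.act_surj[of s] that unfolding topF by simp
          then obtain y' where y': "y' \<in> F" "y = act s y'" by blast
          have "v \<in> K" "p (v - y') \<le> r" using v y'(1) K0(4) unfolding C_def by auto
          moreover have "p (act s v - act s y') \<le> p (v - y')"
            using assms(7) p(1) \<open>v \<in> K\<close> subsetD[OF FK y'(1)]
            unfolding nonexpansive_action_def by simp
          ultimately show ?thesis using y'(2) by simp
        qed
        moreover have "act s v \<in> K0" using v K0(3) unfolding C_def invariant_def by blast
        ultimately show "act s v \<in> C" unfolding C_def using K0(4) by blast
      qed
      show "C \<subseteq> K0" unfolding C_def by blast
    qed
    \<comment> \<open>\<open>F \<subseteq> K0 = C\<close> would bound all distances within
      \<open>F\<close> by \<open>r\<close>.\<close>
    then show False using r F(4) unfolding C_def by force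
  qed
  then have "act s x = x" for s using F(3) x unfolding invariant_def by blast
  then show ?thesis using x FK by blast
qed

end
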